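(* Let $P$ be a countable non-collinear set in the real projective plane in which every line through two points of $P$ contains a third point of $P$, and suppose that the dual line arrangement $\{p^*:p\in P\}$ is locally finite in some affine chart of the dual plane. Then, up to a projective transformation, $P$ is the configuration $\mathcal{C}$, possibly with the common point (vertex) of its three carrier lines adjoined. Both cases occur (i.e. $\mathcal{C}$ and $\mathcal{C}$ with the vertex adjoined both satisfy the hypotheses).
   Context: $\mathcal{C}\subset\mathbb{R}^2$ (viewed in the projective plane) is the following point set: six half-lines issue from a common point, the vertex, at angular spacing $\pi/3$; three alternate half-lines carry the points at distances $1/(3j-2)$, $j\ge1$, from the vertex, and the other three carry the points at distances $1/(3j-1)$, $j\ge1$. The six half-lines form three full lines through the vertex, the carriers. (Equivalently, up to projective transformation, $\mathcal{C}$ is the projective dual of the arrangement of lines $\{x=m\},\{y=n\},\{x+y=k\}$, $m,n,k\in\mathbb{Z}$.) $p^*$ is the line of the dual projective plane dual to the point $p$. An arrangement of lines is locally finite in an affine chart if every disc of the chart meets finitely many of its lines (a line of the arrangement that is the line at infinity of the chart contributes no line to the chart). *)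

theory Defs
  imports "HOL-Analysis.Analysis"
begin

text \<open>
  The real projective plane is modelled by the linear subspaces of \<open>\<real>\<^sup>3\<close>: its points are the
  subspaces of dimension 1, its lines those of dimension 2, and incidence is inclusion.
\<close>

definition proj_points :: "(real^3) set set" where
  "proj_points = {p. subspace p \<and> dim p = 1}"

definition proj_lines :: "(real^3) set set" where
  "proj_lines = {l. subspace l \<and> dim l = 2}"

definition proj_collinear :: "(real^3) set set \<Rightarrow> bool" where
  "proj_collinear P \<longleftrightarrow> (\<exists>l\<in>proj_lines. \<forall>p\<in>P. p \<subseteq> l)"

definition proj_transformation :: "((real^3) set \<Rightarrow> (real^3) set) \<Rightarrow> bool" where
  "proj_transformation T \<longleftrightarrow> (\<exists>f :: real^3 \<Rightarrow> real^3. linear f \<and> bij f \<and> T = image f)"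

definition proj_embed :: "real^2 \<Rightarrow> (real^3) set" where
  "proj_embed z = span {vector [z$1, z$2, 1]}"

text \<open>
  The dual plane is the projective plane of linear forms on \<open>\<real>\<^sup>3\<close>, where a form is given by its
  coefficient vector. The dual of a point \<open>p\<close> is then the line of all forms vanishing on \<open>p\<close>,
  which is the orthogonal complement of \<open>p\<close>.
\<close>

definition dual_line :: "(real^3) set \<Rightarrow> (real^3) set" where
  "dual_line p = orthogonal_comp p"

text \<open>
  An affine chart is given by its inverse \<open>\<phi>\<close>, which maps \<open>\<real>\<^sup>2\<close> onto the complement of a projective
  line. That line, the line at infinity of the chart, meets no disc of the chart.
\<close>

definition affine_chart :: "(real^2 \<Rightarrow> (real^3) set) \<Rightarrow> bool" where
  "affine_chart \<phi> \<longleftrightarrow> (\<exists>T. proj_transformation T \<and> \<phi> = T \<circ> proj_embed)"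

definition locally_finite_in_chart ::
    "(real^2 \<Rightarrow> (real^3) set) \<Rightarrow> (real^3) set set \<Rightarrow> bool" where
  "locally_finite_in_chart \<phi> L \<longleftrightarrow> (\<forall>c r. finite {l\<in>L. \<exists>z\<in>cball c r. \<phi> z \<subseteq> l})"

definition no_ordinary_line :: "(real^3) set set \<Rightarrow> bool" where
  "no_ordinary_line P \<longleftrightarrow>
     (\<forall>l\<in>proj_lines. \<forall>p\<in>P. \<forall>q\<in>P. p \<noteq> q \<and> p \<subseteq> l \<and> q \<subseteq> l \<longrightarrow>
        (\<exists>r\<in>P. r \<noteq> p \<and> r \<noteq> q \<and> r \<subseteq> l))"

definition dually_locally_finite_config :: "(real^3) set set \<Rightarrow> bool" where
  "dually_locally_finite_config P \<longleftrightarrow>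
     P \<subseteq> proj_points \<and> countable P \<and> \<not> proj_collinear P \<and> no_ordinary_line P \<and>
     (\<exists>\<phi>. affine_chart \<phi> \<and> locally_finite_in_chart \<phi> (dual_line ` P))"

definition half_line_dir :: "nat \<Rightarrow> real^2" where
  "half_line_dir k = vector [cos (real k * pi / 3), sin (real k * pi / 3)]"

definition config_C_affine :: "(real^2) set" where
  "config_C_affine =
     {(1 / (3 * real j - 2)) *\<^sub>R half_line_dir k | j k. j \<ge> 1 \<and> k < 6 \<and> even k} \<union>
     {(1 / (3 * real j - 1)) *\<^sub>R half_line_dir k | j k. j \<ge> 1 \<and> k < 6 \<and> odd k}"

definition config_C :: "(real^3) set set" where
  "config_C = proj_embed ` config_C_affine"

definition vertex_C :: "(real^3) set" where
  "vertex_C = proj_embed 0"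

end

theory Submission
  imports Defs
begin

text \<open>
  Dualise: in the given chart the points of \<open>P\<close> become a locally finite arrangement of affine lines
  (a point of \<open>P\<close> may also be dual to the line at infinity), and every crossing of two of these lines
  lies on a third one. Such an arrangement contains no triangle with a fourth line running through one
  of its corners into its interior. Indeed, let \<open>d\<close> be the point where the fourth line leaves the
  triangle \<open>abc\<close> through the side \<open>bc\<close>. The third line through \<open>d\<close> enters one of the triangles \<open>dab\<close>,
  \<open>dac\<close> at its corner \<open>d\<close>, so there is an infinite descent through ever smaller triangles.
  Consequently, of any three lines through a crossing \<open>v\<close>, one is parallel to any given line missing \<open>v\<close>.
  So there are exactly three directions, and their offsets from \<open>v\<close> form one and the same discrete
  subgroup of the reals: the arrangement is the triangular lattice arrangement, up to an affine map.
\<close>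

subsection \<open>Lines in the affine plane\<close>

text \<open>The vector \<open>n\<close> is a normal. The set is a genuine line only for nonzero
  \<open>n\<close>, which is why that condition recurs throughout.\<close>

definition aline :: "real^2 \<Rightarrow> real \<Rightarrow> (real^2) set" where
  "aline n c = {z. n \<bullet> z = c}"

text \<open>The determinant with rows \<open>n\<close> and \<open>m\<close>; for nonzero normals it
  vanishes exactly when the lines are parallel or equal.\<close>

definition cross2 :: "real^2 \<Rightarrow> real^2 \<Rightarrow> real" where
  "cross2 n m = n$1 * m$2 - n$2 * m$1"

lemma mem_aline [simp]: "z \<in> aline n c \<longleftrightarrow> n \<bullet> z = c"
  by (simp add: aline_def)

lemma inner_2: "(x::real^2) \<bullet> y = x$1 * y$1 + x$2 * y$2"
  by (simp add: inner_vec_def sum_2)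

lemma vec2_eq_iff: "(x::real^2) = y \<longleftrightarrow> x$1 = y$1 \<and> x$2 = y$2"
  by (simp add: vec_eq_iff forall_2)

lemma cross2_0 [simp]: "cross2 0 n = 0" "cross2 n 0 = 0"
  by (simp_all add: cross2_def)

lemma cross2_eq_0_imp_scaleR:
  assumes "n \<noteq> 0" "cross2 n m = 0"
  obtains k where "m = k *\<^sub>R n"
proof (cases "n$1 = 0")
  case True
  then have "n$2 \<noteq> 0" using assms(1) by (simp add: vec2_eq_iff)
  with True assms(2) have "m = (m$2 / n$2) *\<^sub>R n"
    by (simp add: cross2_def vec2_eq_iff)
  then show ?thesis by (rule that)
next
  case False
  with assms(2) have "m = (m$1 / n$1) *\<^sub>R n"
    by (simp add: cross2_def vec2_eq_iff field_simps)
  then show ?thesis by (rule that)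
qed

text \<open>Cramer's rule expresses the determinant times each coordinate of \<open>x - y\<close>
  through two differences of inner products, and these vanish.\<close>

lemma cross2_ne_0_eqI:
  assumes "cross2 n m \<noteq> 0" "n \<bullet> x = n \<bullet> y" "m \<bullet> x = m \<bullet> y"
  shows "x = y"
proof -
  have "cross2 n m * (x$1 - y$1) = m$2 * (n \<bullet> x - n \<bullet> y) - n$2 * (m \<bullet> x - m \<bullet> y)"
    "cross2 n m * (x$2 - y$2) = n$1 * (m \<bullet> x - m \<bullet> y) - m$1 * (n \<bullet> x - n \<bullet> y)"
    by (simp_all add: cross2_def inner_2 algebra_simps)
  with assms show ?thesis by (simp add: vec2_eq_iff)
qed

lemma cross2_ne_0_solve:
  assumes "cross2 n m \<noteq> 0"
  obtains z where "n \<bullet> z = a" "m \<bullet> z = b"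
proof
  let ?D = "cross2 n m"
  let ?z = "vector [(a * m$2 - b * n$2) / ?D, (b * n$1 - a * m$1) / ?D] :: real^2"
  have "n \<bullet> ?z = (a * cross2 n m) / ?D" "m \<bullet> ?z = (b * cross2 n m) / ?D"
    unfolding inner_2 cross2_def by (simp_all add: algebra_simps diff_divide_distrib add_divide_distrib)
  with assms show "n \<bullet> ?z = a" "m \<bullet> ?z = b" by simp_all
qed

lemma aline_ne_empty: "n \<noteq> 0 \<Longrightarrow> \<exists>z. n \<bullet> z = (c::real)"
  by (rule exI[of _ "(c / (n \<bullet> n)) *\<^sub>R n"]) simp

lemma aline_scaleR: "k \<noteq> 0 \<Longrightarrow> aline (k *\<^sub>R n) (k * c) = aline n c"
  by (auto simp: aline_def)

lemma aline_eqD: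
  assumes "n \<noteq> 0" "m \<noteq> 0" "aline n c = aline m d"
  obtains k where "k \<noteq> 0" "m = k *\<^sub>R n" "d = k * c"
proof -
  obtain z where z: "n \<bullet> z = c" using aline_ne_empty[OF assms(1)] by blast
  \<comment> \<open>\<open>w\<close> is \<open>n\<close> turned by a right angle, a direction vector
    of the line. The second point \<open>z + w\<close> forces \<open>m\<close> to be orthogonal to
    \<open>w\<close>, hence proportional to \<open>n\<close>.\<close>
  define w :: "real^2" where "w = vector [- n$2, n$1]"
  have "n \<bullet> (z + w) = c" using z by (simp add: inner_2 w_def algebra_simps)
  then have *: "m \<bullet> z = d" "m \<bullet> (z + w) = d" using z assms(3) by (auto simp: aline_def set_eq_iff)
  then have "m \<bullet> w = 0" by (simp add: inner_add_right)
  then have "cross2 n m = 0" by (simp add: cross2_def w_def inner_2 algebra_simps)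
  then obtain k where k: "m = k *\<^sub>R n" using cross2_eq_0_imp_scaleR assms(1) by blast
  show ?thesis using that[of k] k z * assms(2) by auto
qed

lemma aline_eqI:
  assumes "n \<noteq> 0" "m \<noteq> 0" "p \<noteq> q" "p \<in> aline n c" "q \<in> aline n c" "p \<in> aline m d" "q \<in> aline m d"
  shows "aline n c = aline m d"
proof -
  have "cross2 n m = 0" using cross2_ne_0_eqI[of n m p q] assms by auto
  then obtain k where k: "m = k *\<^sub>R n" using cross2_eq_0_imp_scaleR assms(1) by blast
  with assms have "k \<noteq> 0" "d = k * c" by auto
  then show ?thesis using k aline_scaleR by metis
qed

lemma disjoint_alines_scaleR:
  assumes "n \<noteq> 0" "aline n a \<inter> aline m b = {}"
  obtains k where "m = k *\<^sub>R n"
proof -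
  have "cross2 n m = 0"
  proof (rule ccontr)
    assume "cross2 n m \<noteq> 0"
    then obtain z where "n \<bullet> z = a" "m \<bullet> z = b" by (rule cross2_ne_0_solve)
    then have "z \<in> aline n a \<inter> aline m b" by simp
    with assms(2) show False by blast
  qed
  with assms(1) show ?thesis using that by (rule cross2_eq_0_imp_scaleR)
qed

subsection \<open>Arrangements without simple crossings\<close>

text \<open>The least positive element \<open>g\<close> generates the subgroup: the remainder of any
  element modulo \<open>g\<close> lies in the subgroup and in \<open>[0, g)\<close>, so it is
  zero.\<close>

lemma discrete_subgroup_real:
  fixes G :: "real set"
  assumes diff: "\<And>a b. a \<in> G \<Longrightarrow> b \<in> G \<Longrightarrow> a - b \<in> G"
    and fin: "\<And>r. finite (G \<inter> {-r..r})" and x: "x \<in> G" "x \<noteq> 0"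
  obtains g where "g > 0" "G = range (\<lambda>m::int. g * of_int m)"
proof -
  have zero: "0 \<in> G" using diff[OF x(1) x(1)] by simp
  have uminus: "- a \<in> G" if "a \<in> G" for a using diff[OF zero that] by simp
  have add: "a + b \<in> G" if "a \<in> G" "b \<in> G" for a b using diff[OF that(1) uminus[OF that(2)]] by simp
  have mult: "g * of_int m \<in> G" if g: "g \<in> G" for g m
  proof (induction m rule: int_induct[where k = 0])
    case base then show ?case using zero by simp
  next
    case (step1 i) then show ?case using add[OF step1(2) g] by (simp add: distrib_left add.commute)
  next
    case (step2 i) then show ?case using diff[OF step2(2) g] by (simp add: algebra_simps)
  qed
  \<comment> \<open>Cutting off at the absolute value of \<open>x\<close> leaves a finite set that
    still contains this absolute value, so the least positive element exists as a minimum.\<close>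
  define S where "S = {y \<in> G. 0 < y \<and> y \<le> \<bar>x\<bar>}"
  have "finite S" by (rule finite_subset[OF _ fin[of "\<bar>x\<bar>"]]) (auto simp: S_def)
  moreover have "\<bar>x\<bar> \<in> S" using x uminus by (auto simp: S_def abs_if)
  ultimately have g: "Min S \<in> S" and le: "\<And>y. y \<in> S \<Longrightarrow> Min S \<le> y" by (auto intro: Min_in)
  define g where "g = Min S"
  have gpos: "g > 0" "g \<in> G" "g \<le> \<bar>x\<bar>" using g by (auto simp: S_def g_def)
  have "y \<in> range (\<lambda>m::int. g * of_int m)" if y: "y \<in> G" for y
  proof -
    define f where "f = y - g * of_int \<lfloor>y / g\<rfloor>"
    have "f \<in> G" unfolding f_def by (intro diff y mult gpos)
    moreover have "0 \<le> f" "f < g" 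
      using floor_divide_lower[OF gpos(1), of y] floor_divide_upper[OF gpos(1), of y]
      by (simp_all add: f_def algebra_simps)
    ultimately have "f = 0" using le[of f] gpos by (fastforce simp: S_def g_def)
    then show ?thesis by (auto simp: f_def)
  qed
  then have "G = range (\<lambda>m::int. g * of_int m)" using mult gpos by auto
  with gpos(1) show ?thesis by (rule that)
qed

text \<open>The hypotheses on the configuration, dualised and read in the affine chart:
  \<open>third\<close> says that no crossing is simple. Discs about the origin suffice for local
  finiteness, since every bounded set lies in one.\<close>

locale thick_arrangement =
  fixes A :: "(real^2) set set"
  assumes lines: "L \<in> A \<Longrightarrow> \<exists>n c. n \<noteq> 0 \<and> L = aline n c"
    and finite_meeting: "finite {L \<in> A. L \<inter> cball 0 r \<noteq> {}}"
    and third: "L \<in> A \<Longrightarrow> M \<in> A \<Longrightarrow> L \<noteq> M \<Longrightarrow> z \<in> L \<Longrightarrow> z \<in> M \<Longrightarrow> \<exists>N\<in>A. N \<noteq> L \<and> N \<noteq> M \<and> z \<in> N"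
begin

section \<open>Crossings, and triangles cut by a line through a corner\<close>

lemma unique_crossing:
  assumes "L \<in> A" "M \<in> A" "p \<in> L" "p \<in> M" "q \<in> L" "q \<in> M" "p \<noteq> q"
  shows "L = M"
  using lines[OF assms(1)] lines[OF assms(2)] assms aline_eqI by blast

definition crossings :: "(real^2) set" where
  "crossings = {z. \<exists>L\<in>A. \<exists>M\<in>A. L \<noteq> M \<and> z \<in> L \<and> z \<in> M}"

text \<open>Only finitely many lines meet a disc containing \<open>S\<close>, and two distinct lines
  meet in at most one point.\<close>

lemma finite_crossings:
  assumes "bounded S" shows "finite (crossings \<inter> S)"
proof -
  obtain r where r: "S \<subseteq> cball 0 r" using bounded_subset_ballD[OF assms] ball_subset_cball by (meson order_trans)
  define F where "F = {L \<in> A. L \<inter> cball 0 r \<noteq> {}}"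
  have "crossings \<inter> S \<subseteq> (\<Union>(L, M) \<in> {(L, M) \<in> F \<times> F. L \<noteq> M}. L \<inter> M)"
    using r by (fastforce simp: crossings_def F_def)
  moreover have "finite (\<Union>(L, M) \<in> {(L, M) \<in> F \<times> F. L \<noteq> M}. L \<inter> M)"
  proof (rule finite_UN_I)
    show "finite {(L, M) \<in> F \<times> F. L \<noteq> M}"
      by (rule finite_subset[of _ "F \<times> F"]) (auto simp: F_def finite_meeting)
  next
    fix x assume x: "x \<in> {(L, M) \<in> F \<times> F. L \<noteq> M}"
    then obtain L M where LM: "x = (L, M)" "L \<in> A" "M \<in> A" "L \<noteq> M" by (auto simp: F_def)
    then have "\<exists>z. L \<inter> M \<subseteq> {z}" using unique_crossing by blast
    then show "finite (case x of (L, M) \<Rightarrow> L \<inter> M)"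
      using LM by (auto intro: finite_subset)
  qed
  ultimately show ?thesis by (rule finite_subset)
qed

text \<open>The pattern to be excluded: a triangle \<open>abc\<close> with sides on lines of the
  arrangement, and a fourth line running from the corner \<open>a\<close> to an interior point
  \<open>d\<close> of the opposite side. The condition \<open>a \<notin> LA\<close> makes the
  triangle nondegenerate.\<close>

definition cevian :: "real^2 \<Rightarrow> real^2 \<Rightarrow> real^2 \<Rightarrow> real^2 \<Rightarrow> bool" where
  "cevian a b c d \<longleftrightarrow> d \<in> open_segment b c \<and>
     (\<exists>LA\<in>A. \<exists>LB\<in>A. \<exists>LC\<in>A. \<exists>LD\<in>A. {b, c, d} \<subseteq> LA \<and> {a, c} \<subseteq> LB \<and> {a, b} \<subseteq> LC \<and> {a, d} \<subseteq> LD \<and> a \<notin> LA)"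

lemma cevian_sym: "cevian a b c d \<Longrightarrow> cevian a c b d"
  unfolding cevian_def by (auto simp: open_segment_commute)

text \<open>\<open>M\<close> separates \<open>a\<close> from \<open>b\<close>, so it leaves the
  triangle \<open>dab\<close> through the side \<open>ab\<close> at a point \<open>e\<close>, and
  \<open>d\<close> becomes the new apex. The discarded corner \<open>c\<close> lies beyond the line
  \<open>ad\<close>, outside the new triangle.\<close>

lemma cevian_descent_aux:
  assumes cev: "cevian a b c d"
    and M: "M = aline m (m \<bullet> d)" "M \<in> A" and pos: "(m \<bullet> a - m \<bullet> d) * (m \<bullet> b - m \<bullet> d) < 0"
  obtains e where "cevian d a b e" "c \<notin> convex hull {d, a, b}"
proof -
  obtain LA LB LC LD where L: "LA \<in> A" "LB \<in> A" "LC \<in> A" "LD \<in> A" "{b, c, d} \<subseteq> LA" "{a, c} \<subseteq> LB"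
    "{a, b} \<subseteq> LC" "{a, d} \<subseteq> LD" "a \<notin> LA" and d: "d \<in> open_segment b c"
    using cev by (auto simp: cevian_def)
  have bc: "b \<noteq> c" "d \<noteq> b" "d \<noteq> c" using d by (auto simp: open_segment_def)
  \<comment> \<open>The parameter at which the linear form \<open>m\<close> takes its value at
    \<open>d\<close> on the segment from \<open>a\<close> to \<open>b\<close>; the opposite signs
    put it strictly between 0 and 1.\<close>
  define s where "s = (m \<bullet> d - m \<bullet> a) / (m \<bullet> b - m \<bullet> a)"
  have ab: "m \<bullet> b - m \<bullet> a \<noteq> 0" and s: "0 < s" "s < 1"
    using pos by (auto simp: s_def mult_less_0_iff divide_simps)
  define e where "e = (1 - s) *\<^sub>R a + s *\<^sub>R b"
  have "a \<noteq> b" using ab by auto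
  then have e: "e \<in> open_segment a b" using s by (auto simp: in_segment e_def)
  have "m \<bullet> e = m \<bullet> a + s * (m \<bullet> b - m \<bullet> a)" by (simp add: e_def inner_add_right algebra_simps)
  then have "e \<in> M" using ab M by (simp add: s_def)
  have m_d: "d \<in> M" using M by simp
  obtain n k where n: "n \<noteq> 0" "LC = aline n k" using lines L by blast
  then have "e \<in> LC" using L(7) by (simp add: e_def inner_add_right algebra_simps)
  moreover have "d \<notin> LC" using unique_crossing[of LA LC b d] L bc by auto
  \<comment> \<open>In the triangle with apex \<open>d\<close>, the base lies on \<open>LC\<close>,
    the other two sides on \<open>LA\<close> and \<open>LD\<close>, and the cevian on
    \<open>M\<close>.\<close>
  ultimately have cev': "cevian d a b e" unfolding cevian_def
    using e L(1,4,5,7,8) L(3) M(2) \<open>e \<in> M\<close> m_d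
    by (intro conjI bexI[of _ LC] bexI[of _ LA] bexI[of _ LD] bexI[of _ M]) auto
  \<comment> \<open>\<open>q\<close> tells the two sides of the line \<open>ad\<close> apart: the
    hull of \<open>d\<close>, \<open>a\<close>, \<open>b\<close> stays on the side of
    \<open>b\<close>, whereas \<open>c\<close> lies strictly on the other side because
    \<open>d\<close> is between \<open>b\<close> and \<open>c\<close>.\<close>
  obtain q k where q: "q \<noteq> 0" "LD = aline q k" using lines L by blast
  have qb: "q \<bullet> b \<noteq> k" using unique_crossing[of LA LD b d] L q bc by auto
  have qad: "q \<bullet> a = k" "q \<bullet> d = k" using L q by auto
  obtain t where t: "0 < t" "t < 1" "d = (1 - t) *\<^sub>R b + t *\<^sub>R c" using d by (auto simp: in_segment)
  have "c \<notin> convex hull {d, a, b}"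
  proof
    assume "c \<in> convex hull {d, a, b}"
    then obtain u v w where c: "0 \<le> u" "0 \<le> v" "0 \<le> w" "u + v + w = 1" "c = u *\<^sub>R d + v *\<^sub>R a + w *\<^sub>R b"
      by (auto simp: convex_hull_3)
    then have "q \<bullet> c = u * k + v * k + w * (q \<bullet> b)" using qad by (simp add: inner_add_right)
    also have "\<dots> = (u + v + w) * k + w * (q \<bullet> b - k)" by (simp add: algebra_simps)
    finally have qc: "q \<bullet> c - k = w * (q \<bullet> b - k)" using c by simp
    have "(1 - t) * (q \<bullet> b - k) + t * (q \<bullet> c - k) = 0"
      using qad(2) unfolding t(3) inner_add_right by (simp add: algebra_simps)
    then have "((1 - t) + t * w) * (q \<bullet> b - k) = 0" unfolding qc by (simp add: algebra_simps)
    moreover have "(1 - t) + t * w > 0" using t c by (simp add: add_pos_nonneg)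
    ultimately show False using qb by auto
  qed
  with cev' show ?thesis by (rule that)
qed

text \<open>The third line \<open>M\<close> through \<open>d\<close> avoids all three corners. As it
  passes between \<open>b\<close> and \<open>c\<close>, it separates \<open>a\<close> from one of
  them, and the symmetry swapping \<open>b\<close> and \<open>c\<close> covers both cases.\<close>

lemma cevian_descent:
  assumes "cevian a b c d"
  obtains e p q r where "cevian d p q e" "{p, q, r} = {a, b, c}" "r \<in> crossings"
    "r \<notin> convex hull {d, p, q}"
proof -
  obtain LA LB LC LD where L: "LA \<in> A" "LB \<in> A" "LC \<in> A" "LD \<in> A" "{b, c, d} \<subseteq> LA" "{a, c} \<subseteq> LB"
    "{a, b} \<subseteq> LC" "{a, d} \<subseteq> LD" "a \<notin> LA" and d: "d \<in> open_segment b c"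
    using assms by (auto simp: cevian_def)
  have bc: "b \<noteq> c" "d \<noteq> b" "d \<noteq> c" using d by (auto simp: open_segment_def)
  have cr: "b \<in> crossings" "c \<in> crossings" using L by (auto simp: crossings_def)
  obtain M where M: "M \<in> A" "M \<noteq> LA" "M \<noteq> LD" "d \<in> M"
    using third[of LA LD d] L by blast
  obtain m where m: "m \<noteq> 0" "M = aline m (m \<bullet> d)" using lines[OF M(1)] M(4) by auto
  have ma: "m \<bullet> a \<noteq> m \<bullet> d" using unique_crossing[of M LD a d] M L m by auto
  have mb: "m \<bullet> b \<noteq> m \<bullet> d" using unique_crossing[of M LA b d] M L m bc by auto
  obtain t where t: "0 < t" "t < 1" "d = (1 - t) *\<^sub>R b + t *\<^sub>R c" using d by (auto simp: in_segment)
  have "(1 - t) * (m \<bullet> b - m \<bullet> d) + t * (m \<bullet> c - m \<bullet> d) = 0"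
    by (simp add: t(3) inner_add_right algebra_simps)
  \<comment> \<open>As \<open>d\<close> is strictly between \<open>b\<close> and \<open>c\<close>,
    these two lie on opposite sides of \<open>M\<close>.\<close>
  then have opp: "t * (m \<bullet> c - m \<bullet> d) = - ((1 - t) * (m \<bullet> b - m \<bullet> d))" by linarith
  have "(m \<bullet> a - m \<bullet> d) * (m \<bullet> b - m \<bullet> d) < 0 \<or> (m \<bullet> a - m \<bullet> d) * (m \<bullet> c - m \<bullet> d) < 0"
  proof (cases "(m \<bullet> a - m \<bullet> d) * (m \<bullet> b - m \<bullet> d) < 0")
    case False
    then have "(m \<bullet> a - m \<bullet> d) * (m \<bullet> b - m \<bullet> d) > 0" using ma mb
      by (metis linorder_neqE_linordered_idom mult_eq_0_iff right_minus_eq)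
    then have "t * ((m \<bullet> a - m \<bullet> d) * (m \<bullet> c - m \<bullet> d)) < 0"
      unfolding mult.left_commute[of t] opp using t
      by (simp add: mult.left_commute[of _ "1 - t"] del: right_diff_distrib)
    then show ?thesis using t by (simp add: mult_less_0_iff)
  qed blast
  then show ?thesis
  proof
    assume "(m \<bullet> a - m \<bullet> d) * (m \<bullet> b - m \<bullet> d) < 0"
    from cevian_descent_aux[OF assms m(2) M(1) this] show ?thesis
      using that[of a b _ c] cr by blast
  next
    assume "(m \<bullet> a - m \<bullet> d) * (m \<bullet> c - m \<bullet> d) < 0"
    from cevian_descent_aux[OF cevian_sym[OF assms] m(2) M(1) this] show ?thesis
      using that[of a c _ b] cr by (metis insert_commute)
  qed
qed

text \<open>Infinite descent on the finite number of crossings in the triangle: the smaller triangle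
  lies inside the old one and misses its corner \<open>r\<close>, which is itself a
  crossing.\<close>

lemma no_cevian: "\<not> cevian a b c d"
proof (induction "card (crossings \<inter> convex hull {a, b, c})" arbitrary: a b c d rule: less_induct)
  case less
  show ?case
  proof
    assume cev: "cevian a b c d"
    then obtain e p q r where *: "cevian d p q e" "{p, q, r} = {a, b, c}" "r \<in> crossings"
      "r \<notin> convex hull {d, p, q}" by (rule cevian_descent)
    have "d \<in> convex hull {b, c}" using cev
      by (auto simp: cevian_def segment_convex_hull[symmetric] open_segment_def)
    then have "d \<in> convex hull {a, b, c}" by (meson hull_mono subset_insertI subsetD)
    moreover have "{p, q, r} \<subseteq> convex hull {a, b, c}" using *(2) hull_subset by metis
    ultimately have sub: "convex hull {d, p, q} \<subseteq> convex hull {a, b, c}" and "r \<in> convex hull {a, b, c}"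
      by (simp_all add: subset_hull)
    then have "crossings \<inter> convex hull {d, p, q} \<subset> crossings \<inter> convex hull {a, b, c}"
      using *(3,4) by blast
    moreover have "finite (crossings \<inter> convex hull {a, b, c})"
      by (intro finite_crossings finite_imp_bounded_convex_hull) auto
    ultimately have "card (crossings \<inter> convex hull {d, p, q}) < card (crossings \<inter> convex hull {a, b, c})"
      by (rule psubset_card_mono[rotated])
    from less[OF this] *(1) show False by blast
  qed
qed

text \<open>If \<open>M\<close> met all three lines, the middle one of the three intersection points
  would be the foot of a cevian from \<open>v\<close> in the triangle spanned by \<open>v\<close>
  and the outer two.\<close>

lemma one_of_three_parallel:
  assumes L: "L1 \<in> A" "L2 \<in> A" "L3 \<in> A" "L1 \<noteq> L2" "L1 \<noteq> L3" "L2 \<noteq> L3"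
    and v: "v \<in> L1" "v \<in> L2" "v \<in> L3" and M: "M \<in> A" "v \<notin> M"
  shows "M \<inter> L1 = {} \<or> M \<inter> L2 = {} \<or> M \<inter> L3 = {}"
proof (rule ccontr)
  assume "\<not> ?thesis"
  then obtain a b c where abc: "a \<in> M" "a \<in> L1" "b \<in> M" "b \<in> L2" "c \<in> M" "c \<in> L3" by blast
  have ne: "a \<noteq> b" "a \<noteq> c" "b \<noteq> c"
    using unique_crossing[of L1 L2 a v] unique_crossing[of L1 L3 a v] unique_crossing[of L2 L3 b v] abc L v M
    by auto
  obtain n k where n: "n \<noteq> 0" "M = aline n k" using lines M by blast
  have "collinear M"
    unfolding collinear_def
  proof (rule exI, intro ballI)
    fix x y assume "x \<in> M" "y \<in> M"
    then have "n \<bullet> (x - y) = 0" using n by (simp add: inner_diff_right)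
    then have "cross2 (vector [- n$2, n$1]) (x - y) = 0"
      by (simp add: cross2_def inner_2)
    moreover have "(vector [- n$2, n$1] :: real^2) \<noteq> 0" using n(1) by (auto simp: vec2_eq_iff)
    ultimately show "\<exists>c. x - y = c *\<^sub>R vector [- n$2, n$1]"
      using cross2_eq_0_imp_scaleR by metis
  qed
  then have "collinear {a, b, c}" using abc by (auto intro: collinear_subset)
  then have "a \<in> open_segment b c \<or> b \<in> open_segment c a \<or> c \<in> open_segment a b"
    using ne unfolding collinear_between_cases between_mem_segment open_segment_def by blast
  then have "cevian v b c a \<or> cevian v c a b \<or> cevian v a b c"
    unfolding cevian_def using abc L v M by blast
  then show False using no_cevian by blast
qed

text \<open>Three lines through the crossing \<open>v\<close> fix three normals, scaled so that the
  third is the sum of the other two. A fourth direction is impossible, and \<open>third\<close>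
  makes the offsets from \<open>v\<close> one common subgroup for all three families, discrete by
  local finiteness. The line \<open>M\<close> off \<open>v\<close> rules out a pencil.\<close>

theorem triangular_lattice:
  assumes "L1 \<in> A" "L2 \<in> A" "L1 \<noteq> L2" "v \<in> L1" "v \<in> L2" "M \<in> A" "v \<notin> M"
  obtains n1 n2 g where "cross2 n1 n2 \<noteq> 0" "g > 0"
    "A = (\<Union>m::int. {aline n1 (n1 \<bullet> v + g * of_int m), aline n2 (n2 \<bullet> v + g * of_int m),
                   aline (n1 + n2) ((n1 + n2) \<bullet> v + g * of_int m)})"
proof -
  obtain L3 where L3: "L3 \<in> A" "L3 \<noteq> L1" "L3 \<noteq> L2" "v \<in> L3" using third assms by metis
  obtain k1 where k1: "k1 \<noteq> 0" "L1 = aline k1 (k1 \<bullet> v)" using lines[OF assms(1)] assms(4) by auto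
  obtain k2 where k2: "k2 \<noteq> 0" "L2 = aline k2 (k2 \<bullet> v)" using lines[OF assms(2)] assms(5) by auto
  obtain n3 where n3: "n3 \<noteq> 0" "L3 = aline n3 (n3 \<bullet> v)" using lines[OF L3(1)] L3(4) by auto
  have scale: "aline (k *\<^sub>R n) ((k *\<^sub>R n) \<bullet> v) = aline n (n \<bullet> v)" if "k \<noteq> 0" for k and n :: "real^2"
    using aline_scaleR[OF that, of n "n \<bullet> v"] by simp
  have nz: "cross2 n m \<noteq> 0" if nm: "n \<noteq> 0" "m \<noteq> 0" "aline n (n \<bullet> v) \<noteq> aline m (m \<bullet> v)" for n m
  proof
    assume "cross2 n m = 0"
    then obtain k where "m = k *\<^sub>R n" using cross2_eq_0_imp_scaleR nm(1) by blast
    then show False using nm scale[of k n] by auto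
  qed
  have c12: "cross2 k1 k2 \<noteq> 0" and c13: "cross2 k1 n3 \<noteq> 0" and c23: "cross2 k2 n3 \<noteq> 0"
    using nz k1 k2 n3 L3 assms(3) by metis+
  \<comment> \<open>Cramer's rule: these multiples are the components of \<open>n3\<close> along
    \<open>k1\<close> and \<open>k2\<close>, so that \<open>n3 = n1 + n2\<close>.\<close>
  define n1 where "n1 = (- cross2 k2 n3 / cross2 k1 k2) *\<^sub>R k1"
  define n2 where "n2 = (cross2 k1 n3 / cross2 k1 k2) *\<^sub>R k2"
  have ne: "- cross2 k2 n3 / cross2 k1 k2 \<noteq> 0" "cross2 k1 n3 / cross2 k1 k2 \<noteq> 0"
    using c12 c13 c23 by simp_all
  have L1: "L1 = aline n1 (n1 \<bullet> v)" and L2: "L2 = aline n2 (n2 \<bullet> v)"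
    unfolding n1_def n2_def k1(2) k2(2) by (rule scale[symmetric, OF ne(1)], rule scale[symmetric, OF ne(2)])
  have sum: "n3 = n1 + n2" using c12
    unfolding n1_def n2_def vec2_eq_iff by (simp add: field_simps) (simp add: cross2_def algebra_simps)
  have n0: "n1 \<noteq> 0" "n2 \<noteq> 0" using k1 k2 c12 c13 c23 by (auto simp: n1_def n2_def)
  have n12: "cross2 n1 n2 \<noteq> 0" using nz n0 L1 L2 assms(3) by blast
  have n13: "cross2 n1 n3 \<noteq> 0" using nz n0 n3 L1 L3 by blast
  have n23: "cross2 n2 n3 \<noteq> 0" using nz n0 n3 L2 L3 by blast
  have parallel: "\<exists>a. N = aline n (n \<bullet> v + a)"
    if N: "N \<in> A" "n \<noteq> 0" "N \<inter> aline n (n \<bullet> v) = {}" for N n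
  proof -
    obtain m c where m: "m \<noteq> 0" "N = aline m c" using lines N(1) by blast
    have "aline n (n \<bullet> v) \<inter> aline m c = {}" using N(3) m(2) by blast
    then obtain k where k: "m = k *\<^sub>R n" by (rule disjoint_alines_scaleR[OF N(2)])
    then have "k \<noteq> 0" using m by auto
    then have "N = aline n (c / k)" using aline_scaleR[of k n "c / k"] m k by simp
    then show ?thesis by (intro exI[of _ "c / k - n \<bullet> v"]) simp
  qed
  \<comment> \<open>Offsets are measured from \<open>v\<close>, so the lines through
    \<open>v\<close> have offset 0.\<close>
  define X where "X n = {a. aline n (n \<bullet> v + a) \<in> A}" for n
  have zero: "0 \<in> X n1" "0 \<in> X n2" "0 \<in> X n3"
    using L1 L2 n3(2) assms(1,2) L3(1) by (simp_all add: X_def)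
  have off: "\<exists>n\<in>{n1, n2, n3}. \<exists>a. N = aline n (n \<bullet> v + a)" if "N \<in> A" "v \<notin> N" for N
  proof -
    have "N \<inter> L1 = {} \<or> N \<inter> L2 = {} \<or> N \<inter> L3 = {}"
      by (rule one_of_three_parallel[OF assms(1,2) L3(1) assms(3) L3(2,3)[symmetric] assms(4,5) L3(4) that])
    then show ?thesis
      using parallel[OF that(1) n0(1)] parallel[OF that(1) n0(2)] parallel[OF that(1) n3(1)]
      unfolding L1[symmetric] L2[symmetric] n3(2)[symmetric] by blast
  qed
  have through: "\<exists>n\<in>{n1, n2, n3}. \<exists>a. N = aline n (n \<bullet> v + a)" if "N \<in> A" for N
  proof (cases "v \<in> N")
    case False
    then show ?thesis using off that by blast
  next
    case True
    show ?thesis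
    proof (rule ccontr)
      assume ne: "\<not> ?thesis"
      then have N: "N \<noteq> L1" "N \<noteq> L2" "N \<noteq> L3" using L1 L2 n3(2) by (metis add_0_right insertI1 insertI2)+
      \<comment> \<open>A fourth line \<open>N\<close> through \<open>v\<close> is excluded by
        counting which of \<open>L1\<close>, \<open>L2\<close>, \<open>L3\<close>, \<open>N\<close>
        are parallel to \<open>M\<close>: any three of them include such a line, yet no two distinct
        lines through \<open>v\<close> can both be parallel to \<open>M\<close>.\<close>
      define D where "D K \<longleftrightarrow> M \<inter> K = {}" for K
      have all: "D K1 \<or> D K2 \<or> D K3"
        if "K1 \<in> A" "K2 \<in> A" "K3 \<in> A" "K1 \<noteq> K2" "K1 \<noteq> K3" "K2 \<noteq> K3" "v \<in> K1" "v \<in> K2" "v \<in> K3" for K1 K2 K3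
        unfolding D_def by (rule one_of_three_parallel[OF that assms(6,7)])
      have one: "\<not> (D K1 \<and> D K2)"
        if K: "K1 \<in> A" "K2 \<in> A" "K1 \<noteq> K2" "v \<in> K1" "v \<in> K2" for K1 K2
      proof
        assume D: "D K1 \<and> D K2"
        obtain m c where m: "m \<noteq> 0" "M = aline m c" using lines assms(6) by blast
        obtain m1 where m1: "m1 \<noteq> 0" "K1 = aline m1 (m1 \<bullet> v)" using lines[OF K(1)] K(4) by auto
        obtain m2 where m2: "m2 \<noteq> 0" "K2 = aline m2 (m2 \<bullet> v)" using lines[OF K(2)] K(5) by auto
        obtain l1 where l1: "m1 = l1 *\<^sub>R m"
          by (rule disjoint_alines_scaleR[OF m(1) conjunct1[OF D, unfolded D_def, unfolded m(2) m1(2)]])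
        obtain l2 where l2: "m2 = l2 *\<^sub>R m"
          by (rule disjoint_alines_scaleR[OF m(1) conjunct2[OF D, unfolded D_def, unfolded m(2) m2(2)]])
        have "l1 \<noteq> 0" "l2 \<noteq> 0" using m1(1) m2(1) l1 l2 by auto
        then show False using K(3) m1(2) m2(2) scale[of l1 m] scale[of l2 m] by (simp only: l1 l2) simp
      qed
      note L = assms(1,2) L3(1) \<open>N \<in> A\<close> and ne = assms(3) L3(2,3)[symmetric] N[symmetric] N and v = assms(4,5) L3(4) True
      have "D L1 \<or> D L2 \<or> D L3" "D L1 \<or> D L2 \<or> D N" "D L1 \<or> D L3 \<or> D N" "D L2 \<or> D L3 \<or> D N"
        by (intro all L ne v)+
      moreover have "\<not> (D L1 \<and> D L2)" "\<not> (D L1 \<and> D L3)" "\<not> (D L2 \<and> D L3)"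
        "\<not> (D L1 \<and> D N)" "\<not> (D L2 \<and> D N)" "\<not> (D L3 \<and> D N)"
        by (intro one L ne v)+
      ultimately show False by blast
    qed
  qed
  \<comment> \<open>Where lines with normals \<open>n\<close> and \<open>m\<close> cross, the third
    line must have the remaining normal \<open>k\<close>, since a line through \<open>z\<close> with
    normal \<open>n\<close> or \<open>m\<close> is one of the two given ones.\<close>
  have closed: "\<exists>c\<in>X k. k \<bullet> z = k \<bullet> v + c"
    if perm: "{n1, n2, n3} \<subseteq> {n, m, k}" "cross2 n m \<noteq> 0" and a: "a \<in> X n" "n \<bullet> z = n \<bullet> v + a"
      and b: "b \<in> X m" "m \<bullet> z = m \<bullet> v + b" for n m k z a b
  proof -
    have nm: "n \<noteq> 0" "m \<noteq> 0" using that(2) by (auto simp: cross2_def)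
    have ne: "aline n (n \<bullet> v + a) \<noteq> aline m (m \<bullet> v + b)"
    proof
      assume "aline n (n \<bullet> v + a) = aline m (m \<bullet> v + b)"
      then obtain l where "m = l *\<^sub>R n" by (rule aline_eqD[OF nm])
      then show False using that(2) by (simp add: cross2_def)
    qed
    obtain N where N: "N \<in> A" "N \<noteq> aline n (n \<bullet> v + a)" "N \<noteq> aline m (m \<bullet> v + b)" "z \<in> N"
      using third[OF _ _ ne, of z] a b by (auto simp: X_def)
    obtain q c where q: "q \<in> {n, m, k}" "N = aline q (q \<bullet> v + c)" using through[OF N(1)] perm(1) by blast
    have "q = k" using q N a(2) b(2) by auto
    then show ?thesis using q N by (auto simp: X_def)
  qed
  \<comment> \<open>At a crossing the offset for \<open>n3\<close> is the sum of those for
    \<open>n1\<close> and \<open>n2\<close>, so any two admissible offsets determine an admissible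
    third. Taking one of them to be 0 shows that the three offset sets coincide.\<close>
  have add: "a + b \<in> X n3" if "a \<in> X n1" "b \<in> X n2" for a b
  proof -
    obtain z where "n1 \<bullet> z = n1 \<bullet> v + a" "n2 \<bullet> z = n2 \<bullet> v + b" using cross2_ne_0_solve n12 by blast
    with closed[of n1 n2 n3 a z b] that n12 show ?thesis by (auto simp: sum inner_add_left)
  qed
  have sub2: "c - a \<in> X n2" if "a \<in> X n1" "c \<in> X n3" for a c
  proof -
    obtain z where "n1 \<bullet> z = n1 \<bullet> v + a" "n3 \<bullet> z = n3 \<bullet> v + c" using cross2_ne_0_solve n13 by blast
    with closed[of n1 n3 n2 a z c] that n13 show ?thesis
      by (auto simp: sum inner_add_left)
  qed
  have sub1: "c - b \<in> X n1" if "b \<in> X n2" "c \<in> X n3" for b c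
  proof -
    obtain z where "n2 \<bullet> z = n2 \<bullet> v + b" "n3 \<bullet> z = n3 \<bullet> v + c" using cross2_ne_0_solve n23 by blast
    with closed[of n2 n3 n1 b z c] that n23 show ?thesis
      by (auto simp: sum inner_add_left)
  qed
  define G where "G = X n3"
  have X1: "X n1 = G" using add[OF _ zero(2)] sub1[OF zero(2)] by (auto simp: G_def)
  have X2: "X n2 = G" using add[OF zero(1)] sub2[OF zero(1)] by (auto simp: G_def)
  have "\<exists>g>0. G = range (\<lambda>m::int. g * of_int m)"
  proof -
    \<comment> \<open>\<open>M\<close> misses \<open>v\<close>, so its offset is a nonzero element
      of \<open>G\<close>.\<close>
    obtain n x where "n \<in> {n1, n2, n3}" "M = aline n (n \<bullet> v + x)" using through[OF assms(6)] by auto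
    then have x: "x \<in> G" "x \<noteq> 0" using X1 X2 assms(6,7) by (auto simp: G_def X_def)
    have fin: "finite (G \<inter> {-r..r})" for r
    proof -
      let ?l = "\<lambda>a. aline n1 (n1 \<bullet> v + a)"
      let ?R = "norm v + \<bar>r\<bar> / norm n1"
      have "?l ` (G \<inter> {-r..r}) \<subseteq> {L \<in> A. L \<inter> cball 0 ?R \<noteq> {}}"
      proof (clarify, intro conjI)
        fix a assume a: "a \<in> G" "a \<in> {-r..r}"
        then show "?l a \<in> A" using X1 by (auto simp: X_def)
        \<comment> \<open>The foot of the perpendicular from \<open>v\<close> is at distance
          \<open>\<bar>a\<bar> / norm n1\<close> from \<open>v\<close>, so all offsets bounded by
          \<open>r\<close> give lines that meet one fixed disc.\<close>
        have l: "v + (a / (n1 \<bullet> n1)) *\<^sub>R n1 \<in> ?l a" using n0 by (simp add: inner_add_right)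
        have "norm ((a / (n1 \<bullet> n1)) *\<^sub>R n1) = \<bar>a\<bar> / norm n1"
          using n0 by (simp add: dot_square_norm power2_eq_square)
        moreover have "\<bar>a\<bar> / norm n1 \<le> \<bar>r\<bar> / norm n1" using a(2) by (intro divide_right_mono) auto
        ultimately have "norm (v + (a / (n1 \<bullet> n1)) *\<^sub>R n1) \<le> ?R"
          using norm_triangle_ineq[of v "(a / (n1 \<bullet> n1)) *\<^sub>R n1"] by linarith
        then show "?l a \<inter> cball 0 ?R \<noteq> {}" using l by (auto simp del: mem_aline)
      qed
      then have "finite (?l ` (G \<inter> {-r..r}))" using finite_meeting finite_subset by blast
      moreover have "inj ?l"
      proof (rule injI)
        fix x y assume eq: "?l x = ?l y"
        obtain z where "n1 \<bullet> z = n1 \<bullet> v + x" using aline_ne_empty[OF n0(1)] by blast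
        with eq show "x = y" by (auto simp: aline_def)
      qed
      ultimately show ?thesis using finite_imageD inj_on_subset by blast
    qed
    have "a - b \<in> G" if "a \<in> G" "b \<in> G" for a b using sub2[of b a] that X1 X2 by (simp add: G_def)
    then show ?thesis using discrete_subgroup_real[OF _ fin x] by metis
  qed
  then obtain g where g: "g > 0" "G = range (\<lambda>m::int. g * of_int m)" by blast
  have "A = (\<Union>a\<in>G. {aline n1 (n1 \<bullet> v + a), aline n2 (n2 \<bullet> v + a), aline n3 (n3 \<bullet> v + a)})"
    (is "_ = ?B")
  proof -
    have mem: "a \<in> G \<longleftrightarrow> aline n (n \<bullet> v + a) \<in> A" if "n \<in> {n1, n2, n3}" for n a
    proof -
      have "X n = G" using that X1 X2 G_def by blast
      then show ?thesis by (auto simp: X_def)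
    qed
    show ?thesis
    proof (intro equalityI subsetI)
      fix N assume "N \<in> A"
      then show "N \<in> ?B" using through[of N] mem by blast
    next
      fix N assume "N \<in> ?B"
      then show "N \<in> A" using mem by blast
    qed
  qed
  then show ?thesis using that[OF n12 g(1)] g(2) by (simp add: sum)
qed

end

subsection \<open>The projective plane in coordinates\<close>

text \<open>Homogeneous coordinates split as 2 + 1. For nonzero \<open>n\<close> the point spanned
  by \<open>lift n c\<close> is dual to the affine line \<open>aline n (- c)\<close>; for
  \<open>n = 0\<close> and nonzero \<open>c\<close> it is the vertex, dual to the line at
  infinity.\<close>

definition lift :: "real^2 \<Rightarrow> real \<Rightarrow> real^3" where
  "lift n c = vector [n$1, n$2, c]"

lemma vec3_eq_iff: "(x::real^3) = y \<longleftrightarrow> x$1 = y$1 \<and> x$2 = y$2 \<and> x$3 = y$3"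
  by (simp add: vec_eq_iff forall_3)

lemma lift_nth [simp]: "lift n c $ 1 = n$1" "lift n c $ 2 = n$2" "lift n c $ 3 = c"
  by (simp_all add: lift_def)

lemma lift_cases: obtains n c where "x = lift n c"
proof
  show "x = lift (vector [x$1, x$2]) (x$3)" by (simp add: vec3_eq_iff)
qed

lemma lift_eq_iff [simp]: "lift n c = lift m d \<longleftrightarrow> n = m \<and> c = d"
  by (simp add: vec3_eq_iff vec2_eq_iff)

lemma lift_eq_0_iff [simp]: "lift n c = 0 \<longleftrightarrow> n = 0 \<and> c = 0"
  by (simp add: vec3_eq_iff vec2_eq_iff)

lemma scaleR_lift: "k *\<^sub>R lift n c = lift (k *\<^sub>R n) (k * c)"
  by (simp add: vec3_eq_iff)

lemma inner_lift [simp]: "lift n c \<bullet> lift m d = n \<bullet> m + c * d"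
  by (simp add: inner_vec_def sum_2 sum_3)

lemma span_scaleR_singleton:
  assumes "k \<noteq> 0" shows "span {k *\<^sub>R x} = span {x::'a::real_vector}"
  using span_image_scale[of "{x}" "\<lambda>_. k"] assms by simp

lemma span_singleton_eqD:
  assumes "span {x} = span {y}" "x \<noteq> 0"
  obtains k where "k \<noteq> 0" "x = k *\<^sub>R (y::'a::real_vector)"
proof -
  have "x \<in> span {y}" using assms(1) span_base by blast
  then obtain k where "x = k *\<^sub>R y" by (auto simp: span_singleton)
  with assms(2) that[of k] show ?thesis by auto
qed

lemma span_singleton_subset_hyperplane [simp]: "span {x} \<subseteq> {y. u \<bullet> y = 0} \<longleftrightarrow> u \<bullet> x = (0::real)"
  by (metis (mono_tags, lifting) empty_subsetI insert_subset mem_Collect_eq span_base singletonI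
      span_minimal subset_iff subspace_hyperplane)

text \<open>Both sides mean that the coefficients differ by a common nonzero factor.\<close>

lemma span_lift_eq_iff:
  assumes "n \<noteq> 0" "m \<noteq> 0"
  shows "span {lift n c} = span {lift m d} \<longleftrightarrow> aline n (- c) = aline m (- d)"
proof
  assume "span {lift n c} = span {lift m d}"
  then obtain k where "k \<noteq> 0" "lift n c = k *\<^sub>R lift m d"
    using span_singleton_eqD assms(1) by (metis lift_eq_0_iff)
  then show "aline n (- c) = aline m (- d)"
    using aline_scaleR[of k m "- d"] by (simp add: scaleR_lift)
next
  assume "aline n (- c) = aline m (- d)"
  then obtain k where "k \<noteq> 0" "m = k *\<^sub>R n" "- d = k * - c" using aline_eqD assms by metis
  then show "span {lift n c} = span {lift m d}"
    using span_scaleR_singleton[of k "lift n c"] by (simp add: scaleR_lift)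
qed

lemma proj_points_iff: "p \<in> proj_points \<longleftrightarrow> (\<exists>x. x \<noteq> 0 \<and> p = span {x})"
proof
  assume "p \<in> proj_points"
  then have p: "subspace p" "dim p = 1" by (auto simp: proj_points_def)
  then obtain x where x: "x \<in> p" "x \<noteq> 0" by (metis dim_eq_0 subsetI singletonI zero_neq_one)
  have "span {x} = p"
    using x p by (intro subspace_dim_equal) (auto simp: span_minimal)
  with x show "\<exists>x. x \<noteq> 0 \<and> p = span {x}" by blast
qed (auto simp: proj_points_def)

lemma proj_lines_iff: "l \<in> proj_lines \<longleftrightarrow> (\<exists>u. u \<noteq> 0 \<and> l = {x. u \<bullet> x = 0})"
proof
  assume "l \<in> proj_lines"
  then have l: "subspace l" "dim l = 2" by (auto simp: proj_lines_def)
  then obtain u where u: "u \<noteq> 0" "span l \<subseteq> {x. u \<bullet> x = 0}"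
    using lowdim_subset_hyperplane[of l] by auto
  then have "l \<subseteq> {x. u \<bullet> x = 0}" using span_base by blast
  then have "l = {x. u \<bullet> x = 0}"
    using l u by (intro subspace_dim_equal) (auto simp: subspace_hyperplane dim_hyperplane)
  with u show "\<exists>u. u \<noteq> 0 \<and> l = {x. u \<bullet> x = 0}" by blast
qed (auto simp: proj_lines_def subspace_hyperplane dim_hyperplane)

lemma proj_embed_lift: "proj_embed z = span {lift z 1}"
  by (simp add: proj_embed_def lift_def)

lemma dual_line_span: "dual_line (span {x}) = {y. x \<bullet> y = 0}"
  by (auto simp: dual_line_def orthogonal_comp_def orthogonal_def span_singleton)

lemma proj_embed_subset_dual_line:
  "proj_embed z \<subseteq> dual_line (span {lift n c}) \<longleftrightarrow> z \<in> aline n (- c)"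
  unfolding dual_line_span proj_embed_lift span_singleton_subset_hyperplane by auto

lemma vertex_C_eq: "vertex_C = span {lift 0 1}"
  by (simp add: vertex_C_def proj_embed_lift)

lemma span_lift_0: "c \<noteq> 0 \<Longrightarrow> span {lift 0 c} = vertex_C"
  using span_scaleR_singleton[of c "lift 0 1"] by (simp add: vertex_C_eq scaleR_lift)

section \<open>Projective transformations and their action on dual charts\<close>

lemma bij_image_eq_iff:
  "bij f \<Longrightarrow> image f p = image f q \<longleftrightarrow> p = q"
  by (simp add: bij_def inj_image_eq_iff)

lemma proj_points_image:
  assumes "linear f" "bij f" "p \<in> proj_points" shows "f ` p \<in> proj_points"
  using assms by (auto simp: proj_points_def linear_subspace_image dim_image_eq[of f] bij_def inj_on_subset)

lemma proj_lines_image: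
  assumes "linear f" "bij f" "p \<in> proj_lines" shows "f ` p \<in> proj_lines"
  using assms by (auto simp: proj_lines_def linear_subspace_image dim_image_eq[of f] bij_def inj_on_subset)

lemma linear_bij_inv:
  assumes "linear f" "bij (f :: real^'n \<Rightarrow> real^'n)" shows "linear (inv f)" "bij (inv f)"
  using assms inj_linear_imp_inv_linear bij_is_inj bij_imp_bij_inv by blast+

lemma proj_transformation_comp:
  "proj_transformation S \<Longrightarrow> proj_transformation T \<Longrightarrow> proj_transformation (S \<circ> T)"
proof -
  assume "proj_transformation S" "proj_transformation T"
  then obtain f g where "linear f" "bij f" "S = image f" "linear g" "bij g" "T = image g"
    by (auto simp: proj_transformation_def)
  then have "linear (f \<circ> g)" "bij (f \<circ> g)" "S \<circ> T = image (f \<circ> g)"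
    by (auto simp: linear_compose bij_comp fun_eq_iff)
  then show ?thesis unfolding proj_transformation_def by blast
qed

lemma linear_bij_adjoint:
  assumes "linear f" "bij (f :: real^'n \<Rightarrow> real^'n)" shows "linear (adjoint f)" "bij (adjoint f)"
  using assms by (simp_all add: adjoint_linear bij_def inj_adjoint_iff_surj surj_adjoint_iff_inj)

text \<open>Pulling a dual line back along \<open>h\<close> gives the dual of the image under the
  adjoint, so moving the chart by \<open>h\<close> amounts to moving the points by
  \<open>adjoint h\<close>. Taking preimages under a bijection is injective on sets and so preserves
  finiteness.\<close>

lemma locally_finite_image_chart:
  fixes h :: "real^3 \<Rightarrow> real^3"
  assumes h: "linear h" "bij h"
  shows "locally_finite_in_chart (image h \<circ> \<phi>) (dual_line ` P) \<longleftrightarrow>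
         locally_finite_in_chart \<phi> (dual_line ` image (adjoint h) ` P)"
proof -
  have dual: "dual_line (adjoint h ` p) = h -` dual_line p" for p
    by (auto simp: dual_line_def orthogonal_comp_def orthogonal_def adjoint_clauses(2)[OF h(1)])
  have "{L \<in> dual_line ` image (adjoint h) ` P. \<exists>z\<in>cball c r. \<phi> z \<subseteq> L} =
        vimage h ` {L \<in> dual_line ` P. \<exists>z\<in>cball c r. (image h \<circ> \<phi>) z \<subseteq> L}" for c r
    by (auto simp: dual image_subset_iff_subset_vimage image_iff)
  moreover have "inj (vimage h)"
    using h(2) by (simp add: inj_def bij_def) (metis surj_image_vimage_eq)
  ultimately show ?thesis
    by (simp add: locally_finite_in_chart_def finite_image_iff inj_on_subset)
qed

lemma config_image:
  assumes f: "linear f" "bij (f :: real^3 \<Rightarrow> real^3)"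
    and P: "P \<subseteq> proj_points" "countable P" "\<not> proj_collinear P" "no_ordinary_line P"
  shows "image f ` P \<subseteq> proj_points" "countable (image f ` P)" "\<not> proj_collinear (image f ` P)"
    "no_ordinary_line (image f ` P)"
proof -
  note inv = linear_bij_inv[OF f]
  have sub: "f ` p \<subseteq> l \<longleftrightarrow> p \<subseteq> inv f ` l" for p l
    using f(2) by (metis bij_def image_mono image_inv_f_f image_f_inv_f)
  show "image f ` P \<subseteq> proj_points" using P(1) proj_points_image[OF f] by blast
  show "countable (image f ` P)" using P(2) by simp
  show "\<not> proj_collinear (image f ` P)"
    using P(3) proj_lines_image[OF inv] unfolding proj_collinear_def by (auto simp: sub)
  show "no_ordinary_line (image f ` P)"
    unfolding no_ordinary_line_def
  proof (intro ballI impI)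
    fix l p' q' assume l: "l \<in> proj_lines" and "p' \<in> image f ` P" "q' \<in> image f ` P"
      and *: "p' \<noteq> q' \<and> p' \<subseteq> l \<and> q' \<subseteq> l"
    then obtain p q where pq: "p \<in> P" "q \<in> P" "p' = f ` p" "q' = f ` q" by blast
    with * have "p \<noteq> q" "p \<subseteq> inv f ` l" "q \<subseteq> inv f ` l" using sub by blast+
    then obtain r where r: "r \<in> P" "r \<noteq> p" "r \<noteq> q" "r \<subseteq> inv f ` l"
      using P(4)[unfolded no_ordinary_line_def, rule_format, of "inv f ` l" p q] pq proj_lines_image[OF inv l]
      by blast
    show "\<exists>r\<in>image f ` P. r \<noteq> p' \<and> r \<noteq> q' \<and> r \<subseteq> l"
      using r by (intro bexI[of _ "f ` r"]) (simp_all add: pq bij_image_eq_iff[OF f(2)] sub)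
  qed
qed

text \<open>The dual plane transforms contragrediently: when \<open>f\<close> acts on the points,
  the chart has to be moved by the adjoint of the inverse of \<open>f\<close>.\<close>

lemma config_transform:
  assumes "dually_locally_finite_config P" "proj_transformation T"
  shows "dually_locally_finite_config (T ` P)"
proof -
  obtain f where f: "linear f" "bij f" "T = image f"
    using assms(2) by (auto simp: proj_transformation_def)
  obtain \<phi> where \<phi>: "affine_chart \<phi>" "locally_finite_in_chart \<phi> (dual_line ` P)"
    using assms(1) by (auto simp: dually_locally_finite_config_def)
  define h where "h = adjoint (inv f)"
  have h: "linear h" "bij h" using linear_bij_adjoint linear_bij_inv f by (auto simp: h_def)
  have "adjoint h = inv f" using adjoint_adjoint linear_bij_inv f by (auto simp: h_def)
  then have "image (adjoint h) ` T ` P = P" using f by (simp add: image_image bij_def image_inv_f_f)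
  then have "locally_finite_in_chart (image h \<circ> \<phi>) (dual_line ` T ` P)"
    using \<phi>(2) locally_finite_image_chart[OF h, of \<phi> "T ` P"] by (simp add: image_image)
  moreover have "proj_transformation (image h)" using h by (auto simp: proj_transformation_def)
  then have "affine_chart (image h \<circ> \<phi>)"
    using \<phi>(1) proj_transformation_comp unfolding affine_chart_def by (metis comp_assoc)
  ultimately show ?thesis
    using config_image[OF f(1,2), of P] assms(1) f(3) by (auto simp: dually_locally_finite_config_def)
qed

text \<open>The given chart is \<open>proj_embed\<close> followed by a linear map; applying the
  adjoint of that map to the points turns the chart into \<open>proj_embed\<close> itself.\<close>

lemma config_standard_chart:
  assumes "dually_locally_finite_config P"
  obtains T where "proj_transformation T" "dually_locally_finite_config (T ` P)"
    "locally_finite_in_chart proj_embed (dual_line ` T ` P)"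
proof -
  obtain h where h: "linear h" "bij h" "locally_finite_in_chart (image h \<circ> proj_embed) (dual_line ` P)"
    using assms by (auto simp: dually_locally_finite_config_def affine_chart_def proj_transformation_def)
  have T: "proj_transformation (image (adjoint h))"
    using linear_bij_adjoint[OF h(1,2)] by (auto simp: proj_transformation_def)
  show ?thesis
    by (rule that[OF T config_transform[OF assms T]])
      (use h locally_finite_image_chart in blast)
qed

subsection \<open>The triangular lattice configuration\<close>

text \<open>The matrix with columns \<open>lift n1 c1\<close>, \<open>lift n2 c2\<close>,
  \<open>lift 0 g\<close>. It carries the standard lattice points to those with normals
  \<open>n1\<close>, \<open>n2\<close>, \<open>n1 + n2\<close> and offsets in progressions of step
  \<open>g\<close>; the last column makes it fix the vertex for nonzero \<open>g\<close>.\<close>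

definition frame_map :: "real^2 \<Rightarrow> real \<Rightarrow> real^2 \<Rightarrow> real \<Rightarrow> real \<Rightarrow> real^3 \<Rightarrow> real^3" where
  "frame_map n1 c1 n2 c2 g x = x$1 *\<^sub>R lift n1 c1 + x$2 *\<^sub>R lift n2 c2 + x$3 *\<^sub>R lift 0 g"

definition triangular_dirs :: "(real^2) set" where
  "triangular_dirs = {vector [1, 0], vector [0, 1], vector [1, 1]}"

text \<open>In the standard chart the dual lines are \<open>x = m\<close>, \<open>y = m\<close> and
  \<open>x + y = m\<close> for all integers \<open>m\<close>, the triangular lattice arrangement up
  to an affine map.\<close>

definition triangular_config :: "(real^3) set set" where
  "triangular_config = {span {lift d (of_int m)} | d (m::int). d \<in> triangular_dirs}"

lemma frame_map_lift:
  "frame_map n1 c1 n2 c2 g (lift d c) = lift (d$1 *\<^sub>R n1 + d$2 *\<^sub>R n2) (d$1 * c1 + d$2 * c2 + c * g)"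
  by (simp add: frame_map_def vec3_eq_iff)

lemma linear_frame_map: "linear (frame_map n1 c1 n2 c2 g)"
  by (intro linearI) (simp_all add: frame_map_def vec3_eq_iff algebra_simps)

lemma bij_frame_map:
  assumes "cross2 n1 n2 \<noteq> 0" "g \<noteq> 0"
  shows "bij (frame_map n1 c1 n2 c2 g)"
proof -
  have "x = 0" if "frame_map n1 c1 n2 c2 g x = 0" for x
  proof -
    obtain d c where x: "x = lift d c" using lift_cases by blast
    with that have d: "d$1 *\<^sub>R n1 + d$2 *\<^sub>R n2 = 0" and c: "d$1 * c1 + d$2 * c2 + c * g = 0"
      by (simp_all add: frame_map_lift)
    \<comment> \<open>Taking determinants against \<open>n2\<close> and \<open>n1\<close> isolates
      the two coefficients.\<close>
    have "d$1 * cross2 n1 n2 = cross2 (d$1 *\<^sub>R n1 + d$2 *\<^sub>R n2) n2"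
      "d$2 * cross2 n1 n2 = cross2 n1 (d$1 *\<^sub>R n1 + d$2 *\<^sub>R n2)"
      by (simp_all add: cross2_def algebra_simps)
    then have "d$1 * cross2 n1 n2 = 0" "d$2 * cross2 n1 n2 = 0"
      unfolding d by simp_all
    with assms have "d$1 = 0" "d$2 = 0" by simp_all
    with c assms x show ?thesis by (simp add: vec2_eq_iff)
  qed
  then have "inj (frame_map n1 c1 n2 c2 g)"
    using linear_injective_0[OF linear_frame_map] by blast
  then show ?thesis
    using linear_injective_imp_surjective[OF linear_frame_map] by (auto simp: bij_def)
qed

lemma image_span_singleton: "linear f \<Longrightarrow> f ` span {x} = span {f x}"
  using linear_span_image[of f "{x}"] by simp

lemma frame_map_vertex:
  assumes "g \<noteq> 0" shows "frame_map n1 c1 n2 c2 g ` vertex_C = vertex_C"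
proof -
  have "frame_map n1 c1 n2 c2 g ` vertex_C = span {lift 0 g}"
    by (simp add: vertex_C_eq image_span_singleton[OF linear_frame_map] frame_map_lift)
  then show ?thesis using span_lift_0[OF assms] by simp
qed

lemma frame_map_triangular:
  "image (frame_map n1 c1 n2 c2 g) ` triangular_config =
   (\<Union>m::int. {span {lift n1 (c1 + g * of_int m)}, span {lift n2 (c2 + g * of_int m)},
             span {lift (n1 + n2) (c1 + c2 + g * of_int m)}})"
proof -
  have eq: "triangular_config = (\<Union>m::int. {span {lift (vector [1, 0]) (of_int m)},
      span {lift (vector [0, 1]) (of_int m)}, span {lift (vector [1, 1]) (of_int m)}})"
    unfolding triangular_config_def triangular_dirs_def by blast
  show ?thesis
    unfolding eq by (simp add: image_UN image_span_singleton[OF linear_frame_map] frame_map_lift mult.commute)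
qed

section \<open>The lattice configuration satisfies the hypotheses\<close>

lemma triangular_dirs_nonzero: "d \<in> triangular_dirs \<Longrightarrow> d \<noteq> 0"
  by (auto simp: triangular_dirs_def vec2_eq_iff)

text \<open>No direction is a multiple of another one, and each is only the multiple by 1 of itself,
  so a point determines both its direction and its offset.\<close>

lemma triangular_points_eq_iff:
  assumes "d \<in> triangular_dirs" "d' \<in> triangular_dirs"
  shows "span {lift d c} = span {lift d' c'} \<longleftrightarrow> d = d' \<and> c = c'"
proof
  assume "span {lift d c} = span {lift d' c'}"
  then obtain k where k: "lift d c = k *\<^sub>R lift d' c'"
    using span_singleton_eqD triangular_dirs_nonzero[OF assms(1)] by (metis lift_eq_0_iff)
  then have "d = k *\<^sub>R d'" "c = k * c'" by (simp_all add: scaleR_lift)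
  moreover from this(1) have "k = 1"
    using assms by (auto simp: triangular_dirs_def vec2_eq_iff)
  ultimately show "d = d' \<and> c = c'" by simp
qed simp

lemma triangular_points_ne_vertex:
  assumes "d \<noteq> 0" shows "span {lift d c} \<noteq> vertex_C"
proof
  assume "span {lift d c} = vertex_C"
  then obtain k where "lift d c = k *\<^sub>R lift 0 1"
    using span_singleton_eqD[of "lift d c" "lift 0 1"] assms by (auto simp: vertex_C_eq)
  with assms show False by (simp add: scaleR_lift)
qed

text \<open>Among \<open>e1\<close>, \<open>e2\<close> and \<open>e1 + e2\<close>, each is a
  combination of the other two with coefficients 1 or -1. Integrality is what keeps the third point
  of a line in the configuration.\<close>

lemma third_direction:
  assumes "d \<in> triangular_dirs" "d' \<in> triangular_dirs" "d \<noteq> d'"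
  obtains s t :: int where "of_int s *\<^sub>R d + of_int t *\<^sub>R d' \<in> triangular_dirs - {d, d'}"
proof -
  note thesis = that
  define e1 e2 :: "real^2" where "e1 = vector [1, 0]" and "e2 = vector [0, 1]"
  have "vector [1, 1] = e1 + e2" by (simp add: e1_def e2_def vec2_eq_iff)
  then have dirs: "triangular_dirs = {e1, e2, e1 + e2}"
    by (simp add: triangular_dirs_def e1_def e2_def)
  have ne: "e1 \<noteq> 0" "e2 \<noteq> 0" "e1 \<noteq> e2" by (simp_all add: e1_def e2_def vec2_eq_iff)
  have key: ?thesis if "e = of_int s *\<^sub>R d + of_int t *\<^sub>R d'" "e \<in> triangular_dirs - {d, d'}"
    for e and s t :: int
    using that thesis by blast
  consider "d = e1" "d' = e2" | "d = e2" "d' = e1" | "d = e1" "d' = e1 + e2"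
    | "d = e1 + e2" "d' = e1" | "d = e2" "d' = e1 + e2" | "d = e1 + e2" "d' = e2"
    using assms unfolding dirs by blast
  then show ?thesis
  proof cases
    case 1 with ne show ?thesis by (intro key[of "e1 + e2" 1 1]) (simp_all add: dirs)
  next
    case 2 with ne show ?thesis by (intro key[of "e1 + e2" 1 1]) (simp_all add: dirs)
  next
    case 3 with ne show ?thesis by (intro key[of e2 "- 1" 1]) (simp_all add: dirs)
  next
    case 4 with ne show ?thesis by (intro key[of e2 1 "- 1"]) (simp_all add: dirs)
  next
    case 5 with ne show ?thesis by (intro key[of e1 "- 1" 1]) (simp_all add: dirs)
  next
    case 6 with ne show ?thesis by (intro key[of e1 1 "- 1"]) (simp_all add: dirs)
  qed
qed

text \<open>For two points on different carriers, the integer combination of their vectors given by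
  \<open>third_direction\<close> is a third point on the line. If both are on one carrier, or one is
  the vertex, the line is that carrier and holds infinitely many points.\<close>

lemma triangular_no_ordinary_line:
  assumes P: "P = triangular_config \<or> P = insert vertex_C triangular_config"
  shows "no_ordinary_line P"
  unfolding no_ordinary_line_def
proof (intro ballI impI)
  fix l p q assume "l \<in> proj_lines" and pq: "p \<in> P" "q \<in> P" and *: "p \<noteq> q \<and> p \<subseteq> l \<and> q \<subseteq> l"
  then obtain u where l: "l = {x. u \<bullet> x = 0}" by (auto simp: proj_lines_iff)
  obtain w c where u: "u = lift w c" by (rule lift_cases)
  have tri: "span {lift d (of_int m)} \<in> P" if "d \<in> triangular_dirs" for d and m :: int
    using P that by (auto simp: triangular_config_def)
  have on: "span {lift d m} \<subseteq> l \<longleftrightarrow> w \<bullet> d + c * m = 0" for d m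
    by (simp add: l u)
  \<comment> \<open>\<open>c = 0\<close> says that the line passes through the vertex. It then
    contains every point of direction \<open>d\<close>, and an index beyond both bounds
    \<open>a\<close> and \<open>b\<close> avoids \<open>p\<close> and \<open>q\<close>.\<close>
  have same: "\<exists>r\<in>P. r \<noteq> p \<and> r \<noteq> q \<and> r \<subseteq> l"
    if d: "d \<in> triangular_dirs" and m: "w \<bullet> d + c * of_int m = 0" and "c = 0"
    and p: "p = vertex_C \<or> (\<exists>k::int. p = span {lift d (of_int k)})"
    and q: "q = vertex_C \<or> (\<exists>k::int. q = span {lift d (of_int k)})" for d and m :: int
  proof -
    obtain a where a: "\<And>k. k > a \<Longrightarrow> span {lift d (of_int k)} \<noteq> p"
      using p triangular_points_eq_iff[OF d d] triangular_points_ne_vertex[OF triangular_dirs_nonzero[OF d]]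
      by (metis of_int_eq_iff order_less_irrefl)
    obtain b where b: "\<And>k. k > b \<Longrightarrow> span {lift d (of_int k)} \<noteq> q"
      using q triangular_points_eq_iff[OF d d] triangular_points_ne_vertex[OF triangular_dirs_nonzero[OF d]]
      by (metis of_int_eq_iff order_less_irrefl)
    show ?thesis
      by (rule bexI[of _ "span {lift d (of_int (max a b + 1))}"])
        (use a[of "max a b + 1"] b[of "max a b + 1"] tri[OF d, of "max a b + 1"] m \<open>c = 0\<close> on in auto)
  qed
  have cases: "p = vertex_C \<or> (\<exists>d\<in>triangular_dirs. \<exists>m::int. p = span {lift d (of_int m)})" if "p \<in> P" for p
    using that P by (auto simp: triangular_config_def)
  have vertex: "vertex_C \<subseteq> l \<longleftrightarrow> c = 0" unfolding vertex_C_eq on by simp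
  show "\<exists>r\<in>P. r \<noteq> p \<and> r \<noteq> q \<and> r \<subseteq> l"
    using cases[OF pq(1)] cases[OF pq(2)]
  proof (elim disjE bexE exE)
    assume "p = vertex_C" "q = vertex_C"
    then show ?thesis using * by blast
  next
    fix d and m :: int assume d: "d \<in> triangular_dirs" "p = vertex_C" "q = span {lift d (of_int m)}"
    show ?thesis
      by (rule same[OF d(1), of m]) (use * d on vertex in auto)
  next
    fix d and m :: int assume d: "d \<in> triangular_dirs" "q = vertex_C" "p = span {lift d (of_int m)}"
    show ?thesis
      by (rule same[OF d(1), of m]) (use * d on vertex in auto)
  next
    fix d d' and m m' :: int
    assume d: "d \<in> triangular_dirs" "p = span {lift d (of_int m)}"
      "d' \<in> triangular_dirs" "q = span {lift d' (of_int m')}"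
    have m: "w \<bullet> d + c * of_int m = 0" "w \<bullet> d' + c * of_int m' = 0" using * d on by auto
    show ?thesis
    proof (cases "d = d'")
      case True
      with * d have "m \<noteq> m'" by auto
      \<comment> \<open>Subtracting the two incidence equations gives \<open>c = 0\<close>, so the
        line is the carrier.\<close>
      moreover have "c * (of_int m - of_int m') = (w \<bullet> d + c * of_int m) - (w \<bullet> d' + c * of_int m')"
        using True by (simp add: algebra_simps)
      then have "c * (of_int m - of_int m') = 0" using m by simp
      ultimately have "c = 0" by simp
      then show ?thesis using same[OF d(1) m(1)] d True by blast
    next
      case False
      then obtain s t :: int where st: "of_int s *\<^sub>R d + of_int t *\<^sub>R d' \<in> triangular_dirs - {d, d'}"
        using third_direction d by metis
      let ?d = "of_int s *\<^sub>R d + of_int t *\<^sub>R d'"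
      have "w \<bullet> ?d + c * of_int (s * m + t * m') =
          of_int s * (w \<bullet> d + c * of_int m) + of_int t * (w \<bullet> d' + c * of_int m')"
        by (simp add: inner_add_right algebra_simps)
      then have "span {lift ?d (of_int (s * m + t * m'))} \<subseteq> l" unfolding on by (simp add: m)
      moreover have "span {lift ?d (of_int (s * m + t * m'))} \<noteq> p" "span {lift ?d (of_int (s * m + t * m'))} \<noteq> q"
        unfolding d using st triangular_points_eq_iff[of ?d] d by blast+
      ultimately show ?thesis using tri[of ?d "s * m + t * m'"] st by blast
    qed
  qed
qed

text \<open>By Cauchy-Schwarz, the dual line of direction \<open>d\<close> and offset
  \<open>m\<close> can contain \<open>z\<close> only if the absolute value of \<open>m\<close> is at
  most \<open>norm d * norm z\<close>. The vertex contributes at most one further line.\<close>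

lemma triangular_locally_finite:
  assumes P: "P \<subseteq> insert vertex_C triangular_config"
  shows "locally_finite_in_chart proj_embed (dual_line ` P)"
  unfolding locally_finite_in_chart_def
proof (intro allI)
  fix c :: "real^2" and r :: real
  \<comment> \<open>Summing the norms gives one bound that serves all three directions.\<close>
  define N where "N = \<lceil>(\<Sum>d\<in>triangular_dirs. norm d) * (norm c + \<bar>r\<bar>)\<rceil>"
  have fin: "finite triangular_dirs" by (simp add: triangular_dirs_def)
  have "{L \<in> dual_line ` P. \<exists>z\<in>cball c r. proj_embed z \<subseteq> L} \<subseteq>
    insert (dual_line vertex_C) ((\<lambda>(d, m). dual_line (span {lift d (of_int m)})) ` (triangular_dirs \<times> {-N..N}))"
  proof
    fix L assume "L \<in> {L \<in> dual_line ` P. \<exists>z\<in>cball c r. proj_embed z \<subseteq> L}"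
    then obtain p z where p: "p \<in> P" "L = dual_line p" and z: "z \<in> cball c r" "proj_embed z \<subseteq> dual_line p" by blast
    show "L \<in> insert (dual_line vertex_C) ((\<lambda>(d, m). dual_line (span {lift d (of_int m)})) ` (triangular_dirs \<times> {-N..N}))"
    proof (cases "p = vertex_C")
      case False
      then obtain d and m :: int where d: "d \<in> triangular_dirs" "p = span {lift d (of_int m)}"
        using p(1) P False unfolding triangular_config_def by blast
      have "d \<bullet> z = - of_int m" using z(2) unfolding d(2) proj_embed_subset_dual_line by simp
      then have "\<bar>real_of_int m\<bar> = \<bar>d \<bullet> z\<bar>" by simp
      also have "\<dots> \<le> norm d * norm z" by (rule Cauchy_Schwarz_ineq2)
      also have "\<dots> \<le> (\<Sum>d\<in>triangular_dirs. norm d) * (norm c + \<bar>r\<bar>)"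
      proof (rule mult_mono)
        show "norm d \<le> (\<Sum>d\<in>triangular_dirs. norm d)" by (rule member_le_sum[OF d(1) _ fin]) simp
        have "norm (z - c) \<le> r" using z(1) by (simp add: dist_norm norm_minus_commute)
        then show "norm z \<le> norm c + \<bar>r\<bar>" using norm_triangle_sub[of z c] by linarith
      qed (auto intro: sum_nonneg)
      finally have "m \<in> {-N..N}" by (auto simp: N_def abs_le_iff) linarith+
      then show ?thesis using d p(2) by auto
    qed (use p in simp)
  qed
  moreover have "finite \<dots>" using fin by simp
  ultimately show "finite {L \<in> dual_line ` P. \<exists>z\<in>cball c r. proj_embed z \<subseteq> L}"
    by (rule finite_subset)
qed

lemma triangular_dually_locally_finite:
  assumes P: "P = triangular_config \<or> P = insert vertex_C triangular_config"
  shows "dually_locally_finite_config P"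
  unfolding dually_locally_finite_config_def
proof (intro conjI)
  have "triangular_config \<subseteq> proj_points"
    using triangular_dirs_nonzero lift_eq_0_iff unfolding triangular_config_def proj_points_iff subset_iff by blast
  moreover have "vertex_C \<in> proj_points"
    unfolding vertex_C_eq proj_points_iff by (rule exI[of _ "lift 0 1"]) simp
  ultimately show "P \<subseteq> proj_points" using P by blast
  have eq: "triangular_config = (\<lambda>(d, m::int). span {lift d (of_int m)}) ` (triangular_dirs \<times> UNIV)"
    by (auto simp: triangular_config_def)
  have "countable (triangular_dirs \<times> (UNIV :: int set))"
    by (intro countable_SIGMA) (auto simp: triangular_dirs_def)
  then have "countable triangular_config" unfolding eq by (rule countable_image)
  then show "countable P" using P by auto
  show "\<not> proj_collinear P"
  proof
    assume "proj_collinear P"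
    then obtain u where u: "u \<noteq> 0" "\<And>p. p \<in> P \<Longrightarrow> p \<subseteq> {x. u \<bullet> x = 0}"
      by (auto simp: proj_collinear_def proj_lines_iff)
    obtain w c where w: "u = lift w c" by (rule lift_cases)
    have "w \<bullet> d + c * of_int m = 0" if "d \<in> triangular_dirs" for d and m :: int
    proof -
      have "span {lift d (of_int m)} \<in> P" using P that by (auto simp: triangular_config_def)
      from u(2)[OF this] show ?thesis by (simp add: w)
    qed
    \<comment> \<open>The vectors \<open>(1, 0, 0)\<close>, \<open>(0, 1, 0)\<close> and
      \<open>(1, 0, 1)\<close> are linearly independent.\<close>
    from this[of "vector [1, 0]" 0] this[of "vector [0, 1]" 0] this[of "vector [1, 0]" 1]
    have "w = 0" "c = 0" by (simp_all add: triangular_dirs_def inner_2 vec2_eq_iff)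
    then show False using u(1) w by simp
  qed
  show "no_ordinary_line P" by (rule triangular_no_ordinary_line[OF P])
  have "proj_transformation (image id)"
    unfolding proj_transformation_def using linear_id bij_id by blast
  then have "affine_chart proj_embed"
    unfolding affine_chart_def by (intro exI[of _ "image id"]) (simp add: fun_eq_iff)
  moreover have "locally_finite_in_chart proj_embed (dual_line ` P)"
    using P by (intro triangular_locally_finite) blast
  ultimately show "\<exists>\<phi>. affine_chart \<phi> \<and> locally_finite_in_chart \<phi> (dual_line ` P)" by blast
qed

section \<open>The configuration C in homogeneous coordinates\<close>

lemma half_line_dir_eqs:
  "half_line_dir 0 = vector [1, 0]" "half_line_dir (Suc 0) = vector [1/2, sqrt 3 / 2]"
  "half_line_dir 2 = vector [- 1/2, sqrt 3 / 2]"
  by (simp_all add: half_line_dir_def cos_60 sin_60 cos_120 sin_120)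

text \<open>Adding 3 to \<open>k\<close> adds \<open>pi\<close> to the angle and changes the parity,
  so each carrier consists of one half-line of either kind.\<close>

lemma half_line_dir_opposite: "half_line_dir (k + 3) = - half_line_dir k"
proof -
  have eq: "real (k + 3) * pi / 3 = real k * pi / 3 + pi" by (simp add: field_simps)
  show ?thesis unfolding half_line_dir_def eq by (simp add: vec2_eq_iff)
qed

text \<open>Rescaling by \<open>s\<close> turns the factor \<open>1 / s\<close> into the third
  coordinate \<open>s\<close>; the reciprocal distances of \<open>config_C\<close> thus become
  arithmetic progressions.\<close>

lemma proj_embed_scaled: "s > 0 \<Longrightarrow> proj_embed ((1 / s) *\<^sub>R z) = span {lift z s}"
  using span_scaleR_singleton[of "1 / s" "lift z s"] by (simp add: proj_embed_lift scaleR_lift)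

lemma span_lift_minus: "span {lift (- z) s} = span {lift z (- s)}"
  using span_scaleR_singleton[of "-1" "lift z (- s)"] by (simp add: scaleR_lift)

text \<open>On a carrier line with direction \<open>z\<close>, the points of the half-line pointing to \<open>- z\<close> take
  the negative third coordinates, so that the two half-lines together use up a residue class mod 3.\<close>

lemma carrier_points:
  fixes a b :: int and f :: "int \<Rightarrow> real"
  assumes f: "\<And>m. f m = 3 * of_int m + of_int a" and "a + b = 3"
  shows "(\<Union>j\<in>{1::nat..}. {span {lift z (3 * real j - of_int b)}, span {lift (- z) (3 * real j - of_int a)}}) =
         (\<Union>m. {span {lift z (f m)}})"
proof (intro equalityI subsetI)
  fix p assume "p \<in> (\<Union>j\<in>{1::nat..}. {span {lift z (3 * real j - of_int b)}, span {lift (- z) (3 * real j - of_int a)}})"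
  then obtain j :: nat where "j \<ge> 1" and
    p: "p = span {lift z (3 * real j - of_int b)} \<or> p = span {lift (- z) (3 * real j - of_int a)}"
    by auto
  \<comment> \<open>Index \<open>j\<close> corresponds to \<open>m = j - 1\<close> on the half-line
    of \<open>z\<close> and to \<open>m = - j\<close> on the opposite one; \<open>a + b = 3\<close>
    makes the two progressions fit together.\<close>
  have "3 * real j - of_int b = f (int j - 1)" "- (3 * real j - of_int a) = f (- int j)"
    using assms by (simp_all add: f algebra_simps flip: of_int_add)
  with p have "p = span {lift z (f (int j - 1))} \<or> p = span {lift z (f (- int j))}"
    unfolding span_lift_minus by simp
  then show "p \<in> (\<Union>m. {span {lift z (f m)}})" by blast
next
  fix p assume "p \<in> (\<Union>m. {span {lift z (f m)}})"
  then obtain m where p: "p = span {lift z (f m)}" by blast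
  have ab: "of_int a + of_int b = (3::real)" using assms(2) by (metis of_int_add of_int_numeral)
  show "p \<in> (\<Union>j\<in>{1::nat..}. {span {lift z (3 * real j - of_int b)}, span {lift (- z) (3 * real j - of_int a)}})"
  proof (cases "m \<ge> 0")
    case True
    then have "f m = 3 * real (nat (m + 1)) - of_int b" "nat (m + 1) \<ge> 1" using ab by (simp_all add: f)
    then show ?thesis unfolding p by (intro UN_I[of "nat (m + 1)"]) simp_all
  next
    case False
    then have "f m = - (3 * real (nat (- m)) - of_int a)" "nat (- m) \<ge> 1" by (simp_all add: f)
    then show ?thesis unfolding p by (intro UN_I[of "nat (- m)"]) (simp_all add: span_lift_minus)
  qed
qed

text \<open>On the carriers of \<open>half_line_dir 0\<close> and \<open>half_line_dir 2\<close> the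
  third coordinates are the integers congruent to 1 mod 3, on that of their sum
  \<open>half_line_dir 1\<close> those congruent to 2. Hence the offsets 1 and 1, adding up to 2,
  and the step 3.\<close>

lemma config_C_eq:
  "config_C = image (frame_map (vector [1, 0]) 1 (vector [- 1/2, sqrt 3 / 2]) 1 3) ` triangular_config"
proof -
  let ?d = half_line_dir
  have C: "config_C = (\<Union>j\<in>{1::nat..}. \<Union>k\<in>{0, 2, 4}. {span {lift (?d k) (3 * real j - 2)}}) \<union>
      (\<Union>j\<in>{1::nat..}. \<Union>k\<in>{1, 3, 5}. {span {lift (?d k) (3 * real j - 1)}})"
  proof -
    have k: "k < 6 \<and> even k \<longleftrightarrow> k \<in> {0, 2, 4}" "k < 6 \<and> odd k \<longleftrightarrow> k \<in> {1, 3, 5}" for k :: nat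
      unfolding insert_iff empty_iff by presburger+
    have "proj_embed ((1 / (3 * real j - 2)) *\<^sub>R ?d k) = span {lift (?d k) (3 * real j - 2)}"
      "proj_embed ((1 / (3 * real j - 1)) *\<^sub>R ?d k) = span {lift (?d k) (3 * real j - 1)}" if "j \<ge> 1" for j k
      using that by (auto intro!: proj_embed_scaled)
    then show ?thesis
      unfolding config_C_def config_C_affine_def image_Un k
      by (intro arg_cong2[where f = "(\<union>)"]) (fastforce simp del: insert_iff)+
  qed
  have opp: "?d 3 = - ?d 0" "?d 4 = - ?d 1" "?d 5 = - ?d 2"
    using half_line_dir_opposite[of 0] half_line_dir_opposite[of 1] half_line_dir_opposite[of 2] by simp_all
  have sum: "?d 1 = ?d 0 + ?d 2" by (simp add: half_line_dir_eqs vec2_eq_iff)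
  have "config_C = (\<Union>j\<in>{1::nat..}. {span {lift (?d 0) (3 * real j - 2)}, span {lift (- ?d 0) (3 * real j - 1)}}) \<union>
      (\<Union>j\<in>{1::nat..}. {span {lift (?d 2) (3 * real j - 2)}, span {lift (- ?d 2) (3 * real j - 1)}}) \<union>
      (\<Union>j\<in>{1::nat..}. {span {lift (?d 1) (3 * real j - 1)}, span {lift (- ?d 1) (3 * real j - 2)}})"
    unfolding C opp[symmetric] by blast
  also have "\<dots> = (\<Union>m::int. {span {lift (?d 0) (1 + 3 * of_int m)}}) \<union>
      (\<Union>m::int. {span {lift (?d 2) (1 + 3 * of_int m)}}) \<union> (\<Union>m::int. {span {lift (?d 1) (1 + 1 + 3 * of_int m)}})"
    using carrier_points[of "\<lambda>m. 1 + 3 * of_int m" 1 2 "?d 0"]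
      carrier_points[of "\<lambda>m. 1 + 3 * of_int m" 1 2 "?d 2"]
      carrier_points[of "\<lambda>m. 1 + 1 + 3 * of_int m" 2 1 "?d 1"] by simp
  also have "\<dots> = image (frame_map (?d 0) 1 (?d 2) 1 3) ` triangular_config"
    unfolding frame_map_triangular sum by blast
  finally show ?thesis by (simp add: half_line_dir_eqs)
qed

subsection \<open>Reduction to the lattice arrangement\<close>

text \<open>The part of the dual arrangement visible in the chart \<open>proj_embed\<close>: the
  condition \<open>n \<noteq> 0\<close> drops the vertex, whose dual is the line at
  infinity.\<close>

definition affine_traces :: "(real^3) set set \<Rightarrow> (real^2) set set" where
  "affine_traces P = {aline n (- c) | n c. n \<noteq> 0 \<and> span {lift n c} \<in> P}"

lemma aline_mem_affine_traces:
  assumes "n \<noteq> 0" shows "aline n c \<in> affine_traces P \<longleftrightarrow> span {lift n (- c)} \<in> P"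
proof
  assume "aline n c \<in> affine_traces P"
  then obtain m d where m: "m \<noteq> 0" "span {lift m d} \<in> P" "aline n c = aline m (- d)"
    by (auto simp: affine_traces_def)
  then have "span {lift n (- c)} = span {lift m d}" using assms by (simp add: span_lift_eq_iff)
  with m show "span {lift n (- c)} \<in> P" by simp
next
  assume "span {lift n (- c)} \<in> P"
  with assms have "aline n (- (- c)) \<in> affine_traces P" unfolding affine_traces_def by blast
  then show "aline n c \<in> affine_traces P" by simp
qed

lemma proj_point_cases:
  assumes "p \<in> proj_points"
  obtains "p = vertex_C" | n c where "n \<noteq> 0" "p = span {lift n c}"
proof -
  obtain x where x: "x \<noteq> 0" "p = span {x}" using assms unfolding proj_points_iff by blast
  obtain n c where nc: "x = lift n c" by (rule lift_cases)
  show ?thesis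
  proof (cases "n = 0")
    case True
    with x nc have "p = vertex_C" using span_lift_0[of c] by simp
    then show ?thesis by (rule that(1))
  next
    case False
    then show ?thesis by (rule that(2)) (simp add: x nc)
  qed
qed

text \<open>A point \<open>z\<close> of the dual chart is the form with coefficients
  \<open>lift z 1\<close>, that is, a projective line missing the vertex. The traces through
  \<open>z\<close> thus correspond to the points of \<open>P\<close> on this line.\<close>

lemma span_lift_subset_polar:
  "span {lift n c} \<subseteq> {x. lift z 1 \<bullet> x = 0} \<longleftrightarrow> z \<in> aline n (- c)"
  unfolding span_singleton_subset_hyperplane by (auto simp: inner_commute[of n])

lemma vertex_C_subset_polar: "vertex_C \<subseteq> {x. lift w 0 \<bullet> x = 0}"
  unfolding vertex_C_eq span_singleton_subset_hyperplane by simp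

lemma proj_point_ne_vertex:
  assumes "p \<in> proj_points" "p \<noteq> vertex_C"
  shows "\<exists>n c. n \<noteq> 0 \<and> p = span {lift n c}"
  using assms(1) by (rule proj_point_cases) (use assms(2) in blast)+

lemma no_ordinary_lineD:
  assumes "no_ordinary_line P" "u \<noteq> 0" "p \<in> P" "q \<in> P" "p \<noteq> q" "p \<subseteq> {x. u \<bullet> x = 0}" "q \<subseteq> {x. u \<bullet> x = 0}"
  obtains r where "r \<in> P" "r \<noteq> p" "r \<noteq> q" "r \<subseteq> {x. u \<bullet> x = 0}"
proof -
  have "{x. u \<bullet> x = 0} \<in> proj_lines" using assms(2) unfolding proj_lines_iff by blast
  from assms(1)[unfolded no_ordinary_line_def, rule_format, OF this assms(3,4)] assms(5-7)
  have "\<exists>r\<in>P. r \<noteq> p \<and> r \<noteq> q \<and> r \<subseteq> {x. u \<bullet> x = 0}" by fast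
  then show ?thesis using that by blast
qed

lemma not_proj_collinearD:
  assumes "\<not> proj_collinear P" "u \<noteq> 0"
  obtains p where "p \<in> P" "\<not> p \<subseteq> {x. u \<bullet> x = 0}"
proof -
  have "{x. u \<bullet> x = 0} \<in> proj_lines" using assms(2) unfolding proj_lines_iff by blast
  then show ?thesis using assms(1) that unfolding proj_collinear_def by (metis (no_types))
qed

text \<open>A crossing of two traces is a line through two points of \<open>P\<close>, and the third
  point of \<open>P\<close> on it again has an affine trace.\<close>

lemma thick_arrangement_affine_traces:
  assumes P: "P \<subseteq> proj_points" "no_ordinary_line P"
    and fin: "locally_finite_in_chart proj_embed (dual_line ` P)"
  shows "thick_arrangement (affine_traces P)"
proof
  fix L assume "L \<in> affine_traces P"
  then show "\<exists>n c. n \<noteq> 0 \<and> L = aline n c" unfolding affine_traces_def by blast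
next
  fix r
  have "{L \<in> affine_traces P. L \<inter> cball 0 r \<noteq> {}} \<subseteq>
      (\<lambda>D. {z. proj_embed z \<subseteq> D}) ` {D \<in> dual_line ` P. \<exists>z\<in>cball 0 r. proj_embed z \<subseteq> D}"
  proof
    fix L assume "L \<in> {L \<in> affine_traces P. L \<inter> cball 0 r \<noteq> {}}"
    then obtain n c z where n: "span {lift n c} \<in> P" "L = aline n (- c)" and z: "z \<in> L" "z \<in> cball 0 r"
      unfolding affine_traces_def by blast
    then have "dual_line (span {lift n c}) \<in> {D \<in> dual_line ` P. \<exists>z\<in>cball 0 r. proj_embed z \<subseteq> D}"
      using proj_embed_subset_dual_line by blast
    moreover have "L = {z. proj_embed z \<subseteq> dual_line (span {lift n c})}"
      unfolding proj_embed_subset_dual_line n by blast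
    ultimately show "L \<in> (\<lambda>D. {z. proj_embed z \<subseteq> D}) ` {D \<in> dual_line ` P. \<exists>z\<in>cball 0 r. proj_embed z \<subseteq> D}"
      by blast
  qed
  moreover have "finite {D \<in> dual_line ` P. \<exists>z\<in>cball 0 r. proj_embed z \<subseteq> D}"
    using fin unfolding locally_finite_in_chart_def by blast
  ultimately show "finite {L \<in> affine_traces P. L \<inter> cball 0 r \<noteq> {}}"
    using finite_surj by blast
next
  fix L M z assume L: "L \<in> affine_traces P" "M \<in> affine_traces P" "L \<noteq> M" "z \<in> L" "z \<in> M"
  then obtain n c m d where n: "n \<noteq> 0" "span {lift n c} \<in> P" "L = aline n (- c)"
    and m: "m \<noteq> 0" "span {lift m d} \<in> P" "M = aline m (- d)"
    unfolding affine_traces_def by blast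
  have "span {lift n c} \<noteq> span {lift m d}" using L(3) n m span_lift_eq_iff by metis
  moreover have "span {lift n c} \<subseteq> {x. lift z 1 \<bullet> x = 0}" "span {lift m d} \<subseteq> {x. lift z 1 \<bullet> x = 0}"
    using L n m unfolding span_lift_subset_polar by simp_all
  moreover have "lift z 1 \<noteq> 0" by simp
  ultimately obtain r where r: "r \<in> P" "r \<noteq> span {lift n c}" "r \<noteq> span {lift m d}" "r \<subseteq> {x. lift z 1 \<bullet> x = 0}"
    using no_ordinary_lineD[OF P(2) _ n(2) m(2)] by metis
  have "r \<in> proj_points" using P r by blast
  then show "\<exists>N\<in>affine_traces P. N \<noteq> L \<and> N \<noteq> M \<and> z \<in> N"
  proof (cases rule: proj_point_cases)
    \<comment> \<open>The vertex is not on a line whose third coefficient is 1.\<close>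
    case 1
    with r(4) have False unfolding vertex_C_eq by simp
    then show ?thesis ..
  next
    case (2 k e)
    show ?thesis
    proof (intro bexI conjI)
      show "aline k (- e) \<in> affine_traces P" using r 2 by (simp add: aline_mem_affine_traces)
      show "aline k (- e) \<noteq> L" "aline k (- e) \<noteq> M"
        using r 2 n m span_lift_eq_iff by metis+
      show "z \<in> aline k (- e)" using r(4) unfolding 2 span_lift_subset_polar .
    qed
  qed
qed

lemma ex_orthogonal_2:
  fixes n :: "real^2"
  obtains w :: "real^2" where "n \<noteq> 0 \<Longrightarrow> w \<noteq> 0" "\<And>m. w \<bullet> m = cross2 n m"
  by (rule that[of "vector [- n$2, n$1]"]) (auto simp: vec2_eq_iff inner_2 cross2_def)

text \<open>Non-collinearity enters three times: for a point \<open>p\<close> other than the vertex,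
  for \<open>q\<close> off the line joining \<open>p\<close> to the vertex, so that the two traces
  cross, and for a point \<open>r\<close> off the line \<open>pq\<close>, whose trace, if it has
  one, misses the crossing.\<close>

lemma crossing_affine_traces:
  assumes P: "P \<subseteq> proj_points" "no_ordinary_line P" "\<not> proj_collinear P"
  obtains L1 L2 M v where "L1 \<in> affine_traces P" "L2 \<in> affine_traces P" "L1 \<noteq> L2" "v \<in> L1" "v \<in> L2"
    "M \<in> affine_traces P" "v \<notin> M"
proof -
  \<comment> \<open>This line passes through the vertex, so a point off it differs from the
    vertex.\<close>
  have "lift (vector [1, 0]) 0 \<noteq> 0" by (simp add: vec2_eq_iff)
  then obtain p where p: "p \<in> P" "\<not> p \<subseteq> {x. lift (vector [1, 0]) 0 \<bullet> x = 0}"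
    by (rule not_proj_collinearD[OF P(3)])
  have "p \<noteq> vertex_C" using p(2) vertex_C_subset_polar by blast
  then obtain n c where n: "n \<noteq> 0" "p = span {lift n c}" using proj_point_ne_vertex p(1) P(1) by blast
  \<comment> \<open>The line with coefficients \<open>lift w 0\<close> joins \<open>p\<close> to the
    vertex; its other points have traces parallel to that of \<open>p\<close>.\<close>
  obtain w where w: "w \<noteq> 0" "\<And>m. w \<bullet> m = cross2 n m" using ex_orthogonal_2 n(1) by metis
  then have "lift w 0 \<noteq> 0" by simp
  then obtain q where q: "q \<in> P" "\<not> q \<subseteq> {x. lift w 0 \<bullet> x = 0}"
    by (rule not_proj_collinearD[OF P(3)])
  have "q \<noteq> vertex_C" using q(2) vertex_C_subset_polar by blast
  then obtain m d where m: "m \<noteq> 0" "q = span {lift m d}" using proj_point_ne_vertex q(1) P(1) by blast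
  have nm: "cross2 n m \<noteq> 0" using q(2) m w by simp
  then obtain v where v: "n \<bullet> v = - c" "m \<bullet> v = - d" by (rule cross2_ne_0_solve)
  define L1 L2 where "L1 = aline n (- c)" and "L2 = aline m (- d)"
  have A: "L1 \<in> affine_traces P" "L2 \<in> affine_traces P"
    using p q n m by (simp_all add: L1_def L2_def aline_mem_affine_traces)
  have "L1 \<noteq> L2"
  proof
    assume "L1 = L2"
    then obtain k where "m = k *\<^sub>R n" using aline_eqD n(1) m(1) L1_def L2_def by metis
    with nm show False by (simp add: cross2_def)
  qed
  moreover have "v \<in> L1" "v \<in> L2" using v by (simp_all add: L1_def L2_def)
  moreover have "\<exists>M\<in>affine_traces P. v \<notin> M"
  proof -
    have "lift v 1 \<noteq> 0" by simp
    then obtain r where r: "r \<in> P" "\<not> r \<subseteq> {x. lift v 1 \<bullet> x = 0}"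
      by (rule not_proj_collinearD[OF P(3)])
    then have "r \<in> proj_points" using P by blast
    then show ?thesis
    proof (cases rule: proj_point_cases)
      case (2 k e)
      from r(2) have "v \<notin> aline k (- e)" unfolding 2 span_lift_subset_polar .
      moreover have "aline k (- e) \<in> affine_traces P" using r 2 by (simp add: aline_mem_affine_traces)
      ultimately show ?thesis by blast
    next
      \<comment> \<open>Here \<open>r\<close> is the vertex and has no trace. The line joining it to
        \<open>p\<close> then holds a third point \<open>s\<close>, whose trace is parallel to
        \<open>L1\<close> and different from it, so it misses \<open>v\<close>.\<close>
      case 1
      have ne: "r \<noteq> p" using 1 \<open>p \<noteq> vertex_C\<close> by simp
      have sub: "r \<subseteq> {x. lift w 0 \<bullet> x = 0}" "p \<subseteq> {x. lift w 0 \<bullet> x = 0}"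
        unfolding 1 n(2) span_singleton_subset_hyperplane
        using w(2)[of n] vertex_C_subset_polar by (simp_all add: cross2_def)
      obtain s where s: "s \<in> P" "s \<noteq> r" "s \<noteq> p" "s \<subseteq> {x. lift w 0 \<bullet> x = 0}"
        by (rule no_ordinary_lineD[OF P(2) \<open>lift w 0 \<noteq> 0\<close> r(1) p(1) ne sub])
      have "s \<in> proj_points" using P s(1) by blast
      then obtain k e where k: "k \<noteq> 0" "s = span {lift k e}" using proj_point_ne_vertex s(2) 1 by blast
      have "cross2 n k = 0" using s(4) k w by simp
      then obtain l where l: "k = l *\<^sub>R n" by (rule cross2_eq_0_imp_scaleR[OF n(1)])
      have "v \<notin> aline k (- e)"
      proof
        assume "v \<in> aline k (- e)"
        then have "e = l * c" using v by (simp add: l)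
        moreover have "l \<noteq> 0" using k l by auto
        ultimately have "s = p" using span_scaleR_singleton[of l "lift n c"] by (simp add: k n l scaleR_lift)
        with s show False by simp
      qed
      moreover have "aline k (- e) \<in> affine_traces P" using s k by (simp add: aline_mem_affine_traces)
      ultimately show ?thesis by blast
    qed
  qed
  ultimately show ?thesis using that A by blast
qed

text \<open>The lattice form of the traces is translated back into points. The traces do not see the
  vertex, so it is removed from \<open>P\<close>.\<close>

lemma standard_chart_config:
  assumes P: "P \<subseteq> proj_points" "no_ordinary_line P" "\<not> proj_collinear P"
    and fin: "locally_finite_in_chart proj_embed (dual_line ` P)"
  obtains n1 c1 n2 c2 g where "cross2 n1 n2 \<noteq> 0" "g > 0"
    "P - {vertex_C} = image (frame_map n1 c1 n2 c2 g) ` triangular_config"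
proof -
  interpret thick_arrangement "affine_traces P" by (rule thick_arrangement_affine_traces[OF P(1,2) fin])
  obtain L1 L2 M v where "L1 \<in> affine_traces P" "L2 \<in> affine_traces P" "L1 \<noteq> L2" "v \<in> L1" "v \<in> L2"
    "M \<in> affine_traces P" "v \<notin> M" by (rule crossing_affine_traces[OF P])
  then obtain n1 n2 g where n: "cross2 n1 n2 \<noteq> 0" "g > 0"
    and A: "affine_traces P = (\<Union>m::int. {aline n1 (n1 \<bullet> v + g * of_int m), aline n2 (n2 \<bullet> v + g * of_int m),
                   aline (n1 + n2) ((n1 + n2) \<bullet> v + g * of_int m)})"
    by (rule triangular_lattice)
  have "cross2 n1 (n1 + n2) \<noteq> 0" using n(1) by (simp add: cross2_def algebra_simps)
  then have n0: "n1 \<noteq> 0" "n2 \<noteq> 0" "n1 + n2 \<noteq> 0" using n(1) by auto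
  define h where "h n m = span {lift n (- (n \<bullet> v) + g * of_int m)}" for n and m :: int
  \<comment> \<open>Passing from a line to its point negates the offset, so the index
    \<open>m\<close> becomes \<open>- m\<close>; both run over all integers.\<close>
  have h: "k \<noteq> 0 \<Longrightarrow> aline k (- e) = aline n (n \<bullet> v + g * of_int m) \<longleftrightarrow> span {lift k e} = h n (- m)"
    if "n \<in> {n1, n2, n1 + n2}" for n m k e
    unfolding h_def using n0 that span_lift_eq_iff[of k n e "- (n \<bullet> v) + g * of_int (- m)"]
    by (auto simp: algebra_simps)
  have "P - {vertex_C} = (\<Union>m::int. {h n1 m, h n2 m, h (n1 + n2) m})"
  proof (intro equalityI subsetI)
    fix p assume p: "p \<in> P - {vertex_C}"
    then obtain k e where k: "k \<noteq> 0" "p = span {lift k e}" using proj_point_ne_vertex P(1) by blast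
    then have "aline k (- e) \<in> affine_traces P" using p by (simp add: aline_mem_affine_traces)
    then obtain m n where "n \<in> {n1, n2, n1 + n2}" "aline k (- e) = aline n (n \<bullet> v + g * of_int m)"
      unfolding A by blast
    with h k have "p = h n (- m)" "n \<in> {n1, n2, n1 + n2}" by auto
    then show "p \<in> (\<Union>m. {h n1 m, h n2 m, h (n1 + n2) m})" by blast
  next
    fix p assume "p \<in> (\<Union>m. {h n1 m, h n2 m, h (n1 + n2) m})"
    then obtain m n where n: "n \<in> {n1, n2, n1 + n2}" "p = h n m" by blast
    then have "aline n (n \<bullet> v + g * of_int (- m)) \<in> affine_traces P" unfolding A by blast
    moreover have "n \<noteq> 0" using n(1) n0 by auto
    ultimately have "h n m \<in> P" by (simp add: aline_mem_affine_traces h_def algebra_simps)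
    moreover have "h n m \<noteq> vertex_C" unfolding h_def using triangular_points_ne_vertex \<open>n \<noteq> 0\<close> by blast
    ultimately show "p \<in> P - {vertex_C}" using n by blast
  qed
  also have "\<dots> = image (frame_map n1 (- (n1 \<bullet> v)) n2 (- (n2 \<bullet> v)) g) ` triangular_config"
    unfolding frame_map_triangular h_def by (simp add: inner_add_left)
  finally show ?thesis by (rule that[OF n])
qed

section \<open>Normal form and classification\<close>

lemma proj_transformation_inverse:
  assumes "proj_transformation T"
  obtains S where "proj_transformation S" "\<forall>x. S (T x) = x"
proof -
  obtain f where f: "linear f" "bij f" "T = image f" using assms by (auto simp: proj_transformation_def)
  have "proj_transformation (image (inv f))"
    using linear_bij_inv[OF f(1,2)] by (auto simp: proj_transformation_def)
  moreover have "\<forall>x. inv f ` T x = x" using f by (simp add: image_inv_f_f bij_is_inj)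
  ultimately show ?thesis by (rule that)
qed

lemma proj_transformation_frame_map:
  "cross2 n1 n2 \<noteq> 0 \<Longrightarrow> g \<noteq> 0 \<Longrightarrow> proj_transformation (image (frame_map n1 c1 n2 c2 g))"
  unfolding proj_transformation_def using linear_frame_map bij_frame_map by blast

text \<open>After the move to the standard chart, the inverse of the frame map brings the points
  onto the lattice configuration. As the frame map fixes the vertex, only the membership of the
  vertex remains open.\<close>

lemma config_triangular:
  assumes "dually_locally_finite_config P"
  obtains T where "proj_transformation T" "T ` P = triangular_config \<or> T ` P = insert vertex_C triangular_config"
proof -
  obtain T where T: "proj_transformation T" "dually_locally_finite_config (T ` P)"
    "locally_finite_in_chart proj_embed (dual_line ` T ` P)"
    by (rule config_standard_chart[OF assms])
  then have TP: "T ` P \<subseteq> proj_points" "no_ordinary_line (T ` P)" "\<not> proj_collinear (T ` P)"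
    unfolding dually_locally_finite_config_def by simp_all
  obtain n1 c1 n2 c2 g where n: "cross2 n1 n2 \<noteq> 0" "g > 0"
    and P: "T ` P - {vertex_C} = image (frame_map n1 c1 n2 c2 g) ` triangular_config"
    by (rule standard_chart_config[OF TP T(3)])
  define F where "F = image (frame_map n1 c1 n2 c2 g)"
  have "proj_transformation F" unfolding F_def using n by (intro proj_transformation_frame_map) auto
  then obtain S where S: "proj_transformation S" "\<forall>x. S (F x) = x" by (rule proj_transformation_inverse)
  have v: "F vertex_C = vertex_C" unfolding F_def using n by (intro frame_map_vertex) auto
  have "T ` P = F ` triangular_config \<or> T ` P = F ` insert vertex_C triangular_config"
  proof (cases "vertex_C \<in> T ` P")
    case True
    then have "T ` P = insert vertex_C (T ` P - {vertex_C})" by blast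
    then show ?thesis unfolding P F_def[symmetric] image_insert v by (rule disjI2)
  next
    case False
    then have "T ` P = T ` P - {vertex_C}" by blast
    then show ?thesis unfolding P F_def[symmetric] by (rule disjI1)
  qed
  then have "S ` T ` P = triangular_config \<or> S ` T ` P = insert vertex_C triangular_config"
    by (elim disjE) (simp_all add: image_image S(2))
  then show ?thesis
    using that[OF proj_transformation_comp[OF S(1) T(1)]] by (simp add: image_comp)
qed

lemma config_C_transformation:
  obtains T where "proj_transformation T" "config_C = T ` triangular_config"
    "insert vertex_C config_C = T ` insert vertex_C triangular_config"
proof -
  define T where "T = image (frame_map (vector [1, 0]) 1 (vector [- 1/2, sqrt 3 / 2]) 1 3)"
  have "proj_transformation T"
    unfolding T_def by (rule proj_transformation_frame_map) (simp_all add: cross2_def)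
  moreover have eq: "config_C = T ` triangular_config" by (simp add: T_def config_C_eq)
  moreover have "T vertex_C = vertex_C" unfolding T_def by (rule frame_map_vertex) simp
  then have "insert vertex_C config_C = T ` insert vertex_C triangular_config"
    unfolding eq image_insert by simp
  ultimately show ?thesis by (rule that)
qed

theorem corollary8p2:
  shows "(\<forall>P :: (real^3) set set. dually_locally_finite_config P \<longrightarrow>
            (\<exists>T. proj_transformation T \<and> (T ` P = config_C \<or> T ` P = insert vertex_C config_C)))
         \<and> dually_locally_finite_config config_C
         \<and> dually_locally_finite_config (insert vertex_C config_C)"
proof -
  obtain M where M: "proj_transformation M" "config_C = M ` triangular_config"
    "insert vertex_C config_C = M ` insert vertex_C triangular_config"
    by (rule config_C_transformation)
  \<comment> \<open>The lattice configuration is the common normal form: \<open>T\<close> brings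
    \<open>P\<close> to it and \<open>M\<close> carries it on to \<open>config_C\<close>.\<close>
  have "\<exists>T. proj_transformation T \<and> (T ` P = config_C \<or> T ` P = insert vertex_C config_C)"
    if P: "dually_locally_finite_config P" for P
  proof -
    obtain T where T: "proj_transformation T"
      "T ` P = triangular_config \<or> T ` P = insert vertex_C triangular_config"
      by (rule config_triangular[OF P])
    have "(M \<circ> T) ` P = M ` T ` P" by (simp add: image_comp)
    then have "(M \<circ> T) ` P = config_C \<or> (M \<circ> T) ` P = insert vertex_C config_C"
      using T(2) M(2,3) by (elim disjE) simp_all
    then show ?thesis using proj_transformation_comp[OF M(1) T(1)] by blast
  qed
  \<comment> \<open>The hypotheses are projectively invariant, so they carry over from the lattice
    configuration along \<open>M\<close>.\<close>
  moreover have "dually_locally_finite_config config_C"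
    unfolding M(2) by (intro config_transform[OF _ M(1)] triangular_dually_locally_finite) simp
  moreover have "dually_locally_finite_config (insert vertex_C config_C)"
    unfolding M(3) by (intro config_transform[OF _ M(1)] triangular_dually_locally_finite) simp
  ultimately show ?thesis by blast
qed

end
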